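(* Let $k$ be a field, $R=k[x_1,\ldots,x_n]$, and let $I$ be an ideal of Veronese type of $R$, i.e. $I=I_{(d;a_1,\ldots,a_n)}$ for some positive integers $d$ and $1\le a_n\le\cdots\le a_1\le d$. Then the following statements are equivalent: (i) $I$ is almost Cohen-Macaulay; (ii) $\operatorname{bight}(I)-\operatorname{ht}(I)\le 1$.
   Context: For positive integers $d$ and $1\le a_n\le\cdots\le a_1\le d$, the ideal of Veronese type $I_{(d;a_1,\ldots,a_n)}$ is the ideal of $R=k[x_1,\ldots,x_n]$ generated by all monomials $x_1^{i_1}\cdots x_n^{i_n}$ of degree $d$ with $i_j\le a_j$ for each $1\le j\le n$. A monomial ideal $I$ is called almost Cohen-Macaulay (aCM) if $\operatorname{depth} R/I\ge \dim R/I-1$, where depth is taken with respect to the homogeneous maximal ideal $\mathfrak m=(x_1,\ldots,x_n)$. $\operatorname{Ass}(I)$ denotes the set of associated primes of $R/I$, $\operatorname{ht}(I)$ is the height of $I$, and $\operatorname{bight}(I)=\max\{\operatorname{height}(\mathfrak p)\mid \mathfrak p\in\operatorname{Ass}(I)\}$ is the big height. *)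

theory Defs
  imports "HOL-Algebra.Algebraic_Closure_Type" "HOL-Algebra.Module"
    "HOL-Library.Poly_Mapping" "HOL-Library.Extended_Nat"
begin

hide_const (open) Modules.module

section \<open>Modules, associated primes and depth\<close>

definition quot_module :: "('a, 'b) ring_scheme \<Rightarrow> 'a set \<Rightarrow> ('a, 'a set) module" where
  "quot_module R I =
    \<lparr>carrier = carrier (R Quot I), monoid.mult = monoid.mult (R Quot I), one = monoid.one (R Quot I),
     ring.zero = ring.zero (R Quot I), add = ring.add (R Quot I),
     module.smult = (\<lambda>r x. (I +>\<^bsub>R\<^esub> r) \<otimes>\<^bsub>R Quot I\<^esub> x)\<rparr>"

lemma (in cring) quot_module_module:
  assumes "ideal I R"
  shows "module R (quot_module R I)"
proof -
  interpret I: ideal I R by fact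
  interpret Q: cring "R Quot I" using I.quotient_is_cring is_cring by blast
  have cl: "I +> r \<in> carrier (R Quot I)" if "r \<in> carrier R" for r
    using I.rcos_ring_hom that by (rule ring_hom_closed)
  show ?thesis
  proof (rule moduleI)
    show "cring R" by (rule is_cring)
    show "abelian_group (quot_module R I)"
    proof (rule abelian_groupI)
      fix x assume "x \<in> carrier (quot_module R I)"
      then show "\<exists>y\<in>carrier (quot_module R I). y \<oplus>\<^bsub>quot_module R I\<^esub> x = \<zero>\<^bsub>quot_module R I\<^esub>"
        by (auto simp: quot_module_def intro: bexI[of _ "\<ominus>\<^bsub>R Quot I\<^esub> x"] Q.l_neg)
    qed (auto simp: quot_module_def Q.a_ac)
  qed (use cl I.rcos_ring_hom in \<open>auto simp: quot_module_def ring_hom_add ring_hom_mult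
        ring_hom_one[of "(+>) I" R "R Quot I"] Q.l_distr Q.r_distr Q.m_assoc\<close>)
qed

definition associated_primes ::
    "('a, 'b) ring_scheme \<Rightarrow> ('a, 'c, 'd) module_scheme \<Rightarrow> 'a set set" where
  "associated_primes R M =
    {P. primeideal P R \<and>
        (\<exists>x\<in>carrier M. P = {r \<in> carrier R. r \<odot>\<^bsub>M\<^esub> x = \<zero>\<^bsub>M\<^esub>})}"

text \<open>\<open>submodule_mult R M F\<close> is the submodule $(F)M$ of $M$.\<close>

definition submodule_mult ::
    "('a, 'b) ring_scheme \<Rightarrow> ('a, 'c, 'd) module_scheme \<Rightarrow> 'a set \<Rightarrow> 'c set" where
  "submodule_mult R M F =
    \<Inter>{N. submodule N R M \<and> {f \<odot>\<^bsub>M\<^esub> x | f x. f \<in> F \<and> x \<in> carrier M} \<subseteq> N}"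

text \<open>Each $f_i$ is a non-zero-divisor on $M/(f_0,\dots,f_{i-1})M$, expressed
  on representatives in $M$, and $M \neq (f_0,\dots,f_{r-1})M$.\<close>

definition regular_sequence ::
    "('a, 'b) ring_scheme \<Rightarrow> ('a, 'c, 'd) module_scheme \<Rightarrow> 'a list \<Rightarrow> bool" where
  "regular_sequence R M fs \<longleftrightarrow>
    set fs \<subseteq> carrier R \<and>
    (\<forall>i<length fs. \<forall>x\<in>carrier M.
        fs ! i \<odot>\<^bsub>M\<^esub> x \<in> submodule_mult R M (set (take i fs)) \<longrightarrow>
        x \<in> submodule_mult R M (set (take i fs))) \<and>
    submodule_mult R M (set fs) \<noteq> carrier M"

definition depth ::
    "('a, 'b) ring_scheme \<Rightarrow> 'a set \<Rightarrow> ('a, 'c, 'd) module_scheme \<Rightarrow> enat" where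
  "depth R J M = (SUP fs \<in> {fs. set fs \<subseteq> J \<and> regular_sequence R M fs}. enat (length fs))"

section \<open>Krull dimension and heights\<close>

definition prime_chain :: "('a, 'b) ring_scheme \<Rightarrow> (nat \<Rightarrow> 'a set) \<Rightarrow> nat \<Rightarrow> bool" where
  "prime_chain R C r \<longleftrightarrow> (\<forall>i\<le>r. primeideal (C i) R) \<and> (\<forall>i<r. C i \<subset> C (Suc i))"

definition Krull_dim :: "('a, 'b) ring_scheme \<Rightarrow> enat" where
  "Krull_dim R = (SUP r \<in> {r. \<exists>C. prime_chain R C r}. enat r)"

definition prime_height :: "('a, 'b) ring_scheme \<Rightarrow> 'a set \<Rightarrow> enat" where
  "prime_height R P = (SUP r \<in> {r. \<exists>C. prime_chain R C r \<and> C r = P}. enat r)"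

definition height :: "('a, 'b) ring_scheme \<Rightarrow> 'a set \<Rightarrow> enat" where
  "height R I = (INF P \<in> {P. primeideal P R \<and> I \<subseteq> P}. prime_height R P)"

definition big_height :: "('a, 'b) ring_scheme \<Rightarrow> 'a set \<Rightarrow> enat" where
  "big_height R I = (SUP P \<in> associated_primes R (quot_module R I). prime_height R P)"

section \<open>Ideals of Veronese type\<close>

text \<open>The variables are indexed by a finite linearly ordered type \<open>'n\<close>, whose elements in
  increasing order stand for $1, \dots, n$ (so $n = $ \<open>CARD('n)\<close> is an arbitrary
  positive integer).\<close>

type_synonym ('n, 'k) mpoly = "('n \<Rightarrow>\<^sub>0 nat) \<Rightarrow>\<^sub>0 'k"

abbreviation poly_ring :: "('n, 'k::field) mpoly ring" where
  "poly_ring \<equiv> ring_of_type_algebra"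

definition monomial :: "('n \<Rightarrow>\<^sub>0 nat) \<Rightarrow> ('n, 'k::field) mpoly" where
  "monomial e = Poly_Mapping.single e 1"

definition var :: "'n \<Rightarrow> ('n, 'k::field) mpoly" where
  "var i = monomial (Poly_Mapping.single i 1)"

definition irrelevant_ideal :: "('n, 'k::field) mpoly set" where
  "irrelevant_ideal = Idl\<^bsub>poly_ring\<^esub> (range var)"

definition veronese_ideal :: "nat \<Rightarrow> ('n::finite \<Rightarrow> nat) \<Rightarrow> ('n, 'k::field) mpoly set" where
  "veronese_ideal d a = Idl\<^bsub>poly_ring\<^esub>
    {monomial e | e. (\<Sum>j\<in>UNIV. Poly_Mapping.lookup e j) = d \<and>
                     (\<forall>j. Poly_Mapping.lookup e j \<le> a j)}"

text \<open>Subtraction on \<^typ>\<open>enat\<close> is truncated at 0, which is harmless here since depths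
  are non-negative.\<close>

definition almost_Cohen_Macaulay :: "('n, 'k::field) mpoly set \<Rightarrow> bool" where
  "almost_Cohen_Macaulay I \<longleftrightarrow>
    depth poly_ring irrelevant_ideal (quot_module poly_ring I) \<ge>
      Krull_dim (poly_ring Quot I) - 1"

end

theory Submission
  imports Defs "HOL-Library.Cardinality"
begin

text \<open>For \<open>I = I_(d;a)\<close> in \<open>n\<close> variables put \<open>b = min n (\<Sum>a - d + 1)\<close> (\<open>0\<close> if \<open>I = 0\<close>). Every prime generated
  by \<open>b > 0\<close> variables is associated, so \<open>b \<le> bight I\<close>; and the first \<open>n - b\<close> elementary symmetric
  polynomials are regular on \<open>R/I\<close>, which yields (ii) \<open>\<Longrightarrow>\<close> (i), as \<open>dim R/I = n - ht I\<close>.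

  Conversely, let \<open>P = (I : u)\<close> be an associated prime, \<open>P_0 \<subset> \<dots> \<subset> P_c = P\<close> a chain of primes,
  \<open>y_i \<in> P_i - P_(i-1)\<close>, and \<open>f_1, \<dots>, f_r\<close> a regular sequence on \<open>R/I\<close> in the irrelevant ideal. For
  large \<open>L\<close> the element \<open>u\<close> is not in \<open>I + (f_1^L, \<dots>, f_r^L)\<close>, and then
  \<open>y_1, \<dots>, y_c, f_1^L, \<dots>, f_r^L\<close> are algebraically independent: in a polynomial relation cancel the
  lowest power of the first element, pass to the next ideal, and repeat. Hence \<open>c + r \<le> n\<close>. The same
  independence argument bounds all dimensions and heights.\<close>

section \<open>Weakly regular sequences on cyclic modules\<close>

text \<open>Elementary symmetric polynomials work over any field: setting a variable to 0 turns them
  into those of the remaining variables, so one explicit sequence serves every ideal met in the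
  induction. The number \<open>b\<close> is the largest size of \<open>F\<close> for which an
  exponent \<open>c\<close> of degree \<open>d - 1\<close> can satisfy \<open>c_j <= a_j\<close>
  everywhere and \<open>c_j <= a_j - 1\<close> on \<open>F\<close>: this needs
  \<open>d - 1 <= s - |F|\<close>, where \<open>s\<close> is the sum of the \<open>a_j\<close>. If
  \<open>c\<close> is moreover full outside \<open>F\<close>, then \<open>(I : x^c)\<close> is the
  prime of \<open>F\<close>. From \<open>b <= bight I <= ht I + 1\<close> the symmetric sequence
  gets length \<open>n - b >= n - ht I - 1\<close>.

  Conversely, a given regular sequence need not be homogeneous, and adding it to \<open>I\<close>
  may swallow \<open>u\<close>; the colon by \<open>u\<close> is then the whole ring and bounds
  nothing. Powers stay weakly regular while their order grows past the degree of \<open>u\<close>,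
  whence \<open>L\<close>. That at most \<open>n\<close> elements are independent follows by
  comparing the number of monomials in them with the number of available exponents.\<close>

abbreviation ideal' :: "'a::comm_ring_1 set \<Rightarrow> bool" where
  "ideal' J \<equiv> ideal J ring_of_type_algebra"

lemma ring_of_type_algebra_simps [simp]:
  "carrier ring_of_type_algebra = (UNIV :: 'a::comm_ring_1 set)"
  "x \<otimes>\<^bsub>ring_of_type_algebra\<^esub> y = (x * y :: 'a)"
  "x \<oplus>\<^bsub>ring_of_type_algebra\<^esub> y = (x + y :: 'a)"
  "\<one>\<^bsub>ring_of_type_algebra\<^esub> = (1 :: 'a)"
  "\<zero>\<^bsub>ring_of_type_algebra\<^esub> = (0 :: 'a)"
  by (simp_all add: ring_of_type_algebra_def)

lemma a_inv_ring_of_type_algebra [simp]: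
  "\<ominus>\<^bsub>ring_of_type_algebra\<^esub> (x :: 'a::comm_ring_1) = - x"
proof -
  interpret R: cring "ring_of_type_algebra :: 'a ring"
    by (rule cring_from_type_algebra)
  show ?thesis
    by (rule R.minus_equality) simp_all
qed

lemma ideal'_iff:
  "ideal' J \<longleftrightarrow> 0 \<in> J \<and> (\<forall>x\<in>J. \<forall>y\<in>J. x + y \<in> J) \<and> (\<forall>x\<in>J. \<forall>r. r * x \<in> J)"
  (is "_ \<longleftrightarrow> ?R")
proof
  assume "ideal' J"
  then interpret ideal J ring_of_type_algebra .
  show ?R
    using additive_subgroup.zero_closed[OF additive_subgroup_axioms]
      additive_subgroup.a_closed[OF additive_subgroup_axioms] I_l_closed by simp
next
  interpret R: cring "ring_of_type_algebra :: 'a ring"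
    by (rule cring_from_type_algebra)
  assume *: ?R
  have "- x \<in> J" if "x \<in> J" for x
    using *[THEN conjunct2, THEN conjunct2, rule_format, OF that, of "-1"] by simp
  then have "subgroup J (add_monoid ring_of_type_algebra)"
    using * by (intro R.add.subgroupI) (auto simp flip: a_inv_def)
  then show "ideal' J"
    using * by (intro idealI R.ring_axioms) (simp_all add: mult.commute)
qed

lemma ideal'I:
  assumes "0 \<in> J" "\<And>x y. x \<in> J \<Longrightarrow> y \<in> J \<Longrightarrow> x + y \<in> J" "\<And>x r. x \<in> J \<Longrightarrow> r * x \<in> J"
  shows "ideal' J"
  using assms by (simp add: ideal'_iff)

lemma
  assumes "ideal' J"
  shows ideal'_0: "0 \<in> J"
    and ideal'_add: "x \<in> J \<Longrightarrow> y \<in> J \<Longrightarrow> x + y \<in> J"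
    and ideal'_mult_left: "x \<in> J \<Longrightarrow> r * x \<in> J"
    and ideal'_mult_right: "x \<in> J \<Longrightarrow> x * r \<in> J"
  using assms by (simp_all add: ideal'_iff) (metis mult.commute)

lemma ideal'_uminus: "ideal' J \<Longrightarrow> x \<in> J \<Longrightarrow> - x \<in> J"
  using ideal'_mult_left[of J x "-1"] by simp

lemma ideal'_diff: "ideal' J \<Longrightarrow> x \<in> J \<Longrightarrow> y \<in> J \<Longrightarrow> x - y \<in> J"
  using ideal'_add[of J x "-y"] ideal'_uminus[of J y] by simp

lemma ideal'_add_cancel: "ideal' J \<Longrightarrow> y \<in> J \<Longrightarrow> x + y \<in> J \<longleftrightarrow> x \<in> J"
  using ideal'_add[of J x y] ideal'_diff[of J "x + y" y] by auto

lemma ideal'_sum: "ideal' J \<Longrightarrow> (\<And>i. i \<in> A \<Longrightarrow> f i \<in> J) \<Longrightarrow> sum f A \<in> J"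
  by (induction A rule: infinite_finite_induct) (auto intro: ideal'_0 ideal'_add)

section \<open>Colon ideals, adjoined elements and weakly regular sequences\<close>

definition nzd :: "'a::comm_ring_1 set \<Rightarrow> 'a \<Rightarrow> bool" where
  "nzd J f \<longleftrightarrow> (\<forall>m. f * m \<in> J \<longrightarrow> m \<in> J)"

definition colon :: "'a::comm_ring_1 set \<Rightarrow> 'a \<Rightarrow> 'a set" where
  "colon J x = {m. x * m \<in> J}"

definition adj :: "'a::comm_ring_1 set \<Rightarrow> 'a \<Rightarrow> 'a set" where
  "adj J x = {j + x * r |j r. j \<in> J}"

text \<open>The condition that the last quotient be non-zero is left out. The induction over colon
  ideals reaches the unit ideal, where this weak form holds trivially; properness is checked
  separately at the end.\<close>

primrec wreg :: "'a::comm_ring_1 set \<Rightarrow> 'a list \<Rightarrow> bool" where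
  "wreg J [] \<longleftrightarrow> True"
| "wreg J (f # fs) \<longleftrightarrow> nzd J f \<and> wreg (adj J f) fs"

abbreviation adjs :: "'a::comm_ring_1 set \<Rightarrow> 'a list \<Rightarrow> 'a set" where
  "adjs \<equiv> foldl adj"

lemma adjI: "j \<in> J \<Longrightarrow> j + x * r \<in> adj J x"
  by (auto simp: adj_def)

lemma adjE: 
  assumes "m \<in> adj J x" obtains j r where "j \<in> J" "m = j + x * r"
  using assms by (auto simp: adj_def)

lemma subset_adj: "J \<subseteq> adj J x"
  using adjI[of _ J x 0] by auto

lemma mem_adj: "ideal' J \<Longrightarrow> x \<in> adj J x"
  using adjI[of 0 J x 1] ideal'_0 by auto

lemma ideal'_adj: assumes "ideal' J" shows "ideal' (adj J x)"
proof (rule ideal'I)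
  show "0 \<in> adj J x" using subset_adj ideal'_0[OF assms] by blast
next
  fix m n assume "m \<in> adj J x" "n \<in> adj J x"
  then obtain j r k s where "j \<in> J" "m = j + x * r" "k \<in> J" "n = k + x * s"
    by (auto elim!: adjE)
  then have "m + n = (j + k) + x * (r + s)" "j + k \<in> J"
    by (auto simp: algebra_simps intro: ideal'_add assms)
  then show "m + n \<in> adj J x" by (simp only: adjI)
next
  fix m q assume "m \<in> adj J x"
  then obtain j r where "j \<in> J" "m = j + x * r"
    by (auto elim!: adjE)
  then have "q * m = q * j + x * (q * r)" "q * j \<in> J"
    by (auto simp: distrib_left mult.left_commute intro: ideal'_mult_left assms)
  then show "q * m \<in> adj J x" by (simp only: adjI)
qed

lemma ideal'_colon: "ideal' J \<Longrightarrow> ideal' (colon J x)"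
  by (auto simp: ideal'_iff colon_def distrib_left mult.left_commute)

lemma ideal'_adjs: "ideal' J \<Longrightarrow> ideal' (adjs J fs)"
  by (induction fs arbitrary: J) (auto intro: ideal'_adj)

lemma adj_mono: "J \<subseteq> K \<Longrightarrow> adj J x \<subseteq> adj K x"
  by (auto simp: adj_def)

lemma adj_least: "ideal' K \<Longrightarrow> J \<subseteq> K \<Longrightarrow> x \<in> K \<Longrightarrow> adj J x \<subseteq> K"
  unfolding adj_def using ideal'_add[of K] ideal'_mult_right[of K] by blast

lemma adjs_least: "ideal' K \<Longrightarrow> J \<subseteq> K \<Longrightarrow> set fs \<subseteq> K \<Longrightarrow> adjs J fs \<subseteq> K"
  by (induction fs arbitrary: J) (simp_all add: adj_least)

lemma subset_adjs: "J \<subseteq> adjs J fs"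
  by (induction fs arbitrary: J) (use subset_adj in force)+

lemma set_subset_adjs: "ideal' J \<Longrightarrow> set fs \<subseteq> adjs J fs"
proof (induction fs arbitrary: J)
  case (Cons f fs)
  then show ?case
    using mem_adj[of J f] subset_adjs[of "adj J f" fs] ideal'_adj[of J f] by auto
qed simp

lemma adj_commute: "adj (adj J x) y = adj (adj J y) x"
proof -
  have "adj (adj J x) y \<subseteq> adj (adj J y) x" for x y
  proof
    fix m assume "m \<in> adj (adj J x) y"
    then obtain j r s where "j \<in> J" "m = (j + x * r) + y * s"
      by (auto elim!: adjE)
    then have "m = (j + y * s) + x * r" "j \<in> J" by (auto simp: algebra_simps)
    then show "m \<in> adj (adj J y) x" by (simp only: adjI)
  qed
  then show ?thesis by blast
qed

lemma nzd_mult: "nzd J f \<Longrightarrow> nzd J g \<Longrightarrow> nzd J (f * g)"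
  unfolding nzd_def mult.assoc by blast

lemma nzd_1: "nzd J 1"
  by (simp add: nzd_def)

lemma nzd_power: "nzd J f \<Longrightarrow> nzd J (f ^ k)"
  by (induction k) (auto intro: nzd_mult nzd_1)

lemma nzd_cong:
  assumes "ideal' J" "f - g \<in> J" shows "nzd J f \<longleftrightarrow> nzd J g"
proof -
  have "f * m = g * m + (f - g) * m" for m by (simp add: algebra_simps)
  moreover have "(f - g) * m \<in> J" for m using assms ideal'_mult_right by blast
  ultimately have "f * m \<in> J \<longleftrightarrow> g * m \<in> J" for m
    by (metis ideal'_add_cancel[OF assms(1)])
  then show ?thesis by (simp add: nzd_def)
qed

lemma wreg_append: "wreg J (fs @ gs) \<longleftrightarrow> wreg J fs \<and> wreg (adjs J fs) gs"
  by (induction fs arbitrary: J) auto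

lemma wreg_UNIV: "wreg UNIV fs"
proof -
  have "adj UNIV f = UNIV" for f :: 'a
    using subset_adj by blast
  then show ?thesis
    by (induction fs) (auto simp: nzd_def)
qed

text \<open>Multiplication by \<open>x\<close> gives the exact sequence 0 -> R/(J : x) -> R/J ->
  R/(J + (x)) -> 0. A non-zero-divisor on both outer terms is one on the middle term, and since
  \<open>g\<close> is regular on the right-hand term, the sequence stays exact modulo
  \<open>g\<close>.\<close>

lemma wreg_colon_adj:
  assumes "ideal' J" "wreg (colon J x) gs" "wreg (adj J x) gs"
  shows "wreg J gs"
  using assms
proof (induction gs arbitrary: J)
  case (Cons g gs)
  have nc: "nzd (colon J x) g" and na: "nzd (adj J x) g"
    using Cons.prems by auto
  have "m \<in> J" if "g * m \<in> J" for m
  proof -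
    have "m \<in> adj J x" using na that subset_adj unfolding nzd_def by blast
    then obtain j r where j: "j \<in> J" "m = j + x * r" by (elim adjE)
    have "g * (x * r) = g * m - g * j" using j by (simp add: algebra_simps)
    then have "x * (g * r) \<in> J"
      using that j Cons.prems(1) by (simp add: ideal'_diff ideal'_mult_left mult.left_commute)
    then have "r \<in> colon J x" using nc by (auto simp: nzd_def colon_def)
    then show ?thesis using j Cons.prems(1) by (auto simp: colon_def intro: ideal'_add)
  qed
  then have nzd: "nzd J g" by (simp add: nzd_def)
  \<comment> \<open>Exactness modulo \<open>g\<close>: taking the colon by \<open>x\<close> commutes
    with adjoining \<open>g\<close>.\<close>
  have "colon (adj J g) x = adj (colon J x) g"
  proof (intro equalityI subsetI)
    fix m assume "m \<in> colon (adj J g) x"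
    then obtain j r where j: "j \<in> J" "x * m = j + g * r" by (auto simp: colon_def elim!: adjE)
    have "- j + x * m \<in> adj J x" using j Cons.prems(1) by (intro adjI ideal'_uminus)
    then have "g * r \<in> adj J x" using j by simp
    then have "r \<in> adj J x" using na by (simp add: nzd_def)
    then obtain i s where i: "i \<in> J" "r = i + x * s" by (elim adjE)
    have "x * (m - g * s) = j + g * i" using i j by (simp add: algebra_simps)
    then have "m - g * s \<in> colon J x"
      using i j Cons.prems(1) by (auto simp: colon_def intro: ideal'_add ideal'_mult_left)
    then have "(m - g * s) + g * s \<in> adj (colon J x) g" by (rule adjI)
    then show "m \<in> adj (colon J x) g" by simp
  next
    fix m assume "m \<in> adj (colon J x) g"
    then obtain j r where j: "x * j \<in> J" "m = j + g * r" by (auto simp: colon_def elim!: adjE)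
    then have "x * m = x * j + g * (x * r)" by (simp add: algebra_simps)
    with j show "m \<in> colon (adj J g) x" by (auto simp: colon_def intro: adjI)
  qed
  then have "wreg (adj J g) gs"
    using Cons.IH[of "adj J g"] Cons.prems by (simp add: ideal'_adj adj_commute[of J g])
  with nzd show ?case by simp
qed simp

text \<open>Induction on the exponent, with the exact sequence for \<open>x = f^(l+1)\<close> and
  the ideal \<open>J + (f^(l+2))\<close>. Cancelling \<open>f^(l+1)\<close> modulo \<open>J\<close>
  shows that the colon is \<open>J + (f)\<close>; adjoining \<open>x\<close> gives
  \<open>J + (f^(l+1))\<close>.\<close>

lemma wreg_adj_power:
  assumes "ideal' J" "nzd J f" "wreg (adj J f) gs"
  shows "wreg (adj J (f ^ Suc l)) gs"
proof (induction l)
  case (Suc l)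
  let ?K = "adj J (f ^ Suc (Suc l))"
  have "colon ?K (f ^ Suc l) = adj J f"
  proof (intro equalityI subsetI)
    fix m assume "m \<in> colon ?K (f ^ Suc l)"
    then obtain j r where j: "j \<in> J" "f ^ Suc l * m = j + f ^ Suc (Suc l) * r"
      by (auto simp: colon_def elim!: adjE)
    then have "f ^ Suc l * (m - f * r) = j" by (simp add: algebra_simps)
    then have "m - f * r \<in> J"
      using j(1) nzd_power[OF assms(2), of "Suc l"] unfolding nzd_def by blast
    then have "(m - f * r) + f * r \<in> adj J f" by (rule adjI)
    then show "m \<in> adj J f" by simp
  next
    fix m assume "m \<in> adj J f"
    then obtain j r where j: "j \<in> J" "m = j + f * r" by (elim adjE)
    then have "f ^ Suc l * m = f ^ Suc l * j + f ^ Suc (Suc l) * r" by (simp add: algebra_simps)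
    moreover have "f ^ Suc l * j \<in> J" using j assms(1) by (intro ideal'_mult_left)
    ultimately show "m \<in> colon ?K (f ^ Suc l)"
      unfolding colon_def using adjI by (metis mem_Collect_eq)
  qed
  moreover have "adj ?K (f ^ Suc l) = adj J (f ^ Suc l)"
  proof
    have "f ^ Suc l * f \<in> adj J (f ^ Suc l)"
      using assms(1) by (intro ideal'_mult_right ideal'_adj mem_adj)
    then have "f ^ Suc (Suc l) \<in> adj J (f ^ Suc l)" by (simp add: mult_ac)
    then show "adj ?K (f ^ Suc l) \<subseteq> adj J (f ^ Suc l)"
      using assms(1) by (intro adj_least ideal'_adj mem_adj subset_adj) auto
    show "adj J (f ^ Suc l) \<subseteq> adj ?K (f ^ Suc l)"
      by (intro adj_mono subset_adj)
  qed
  ultimately show ?case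
    using wreg_colon_adj[of ?K "f ^ Suc l" gs] Suc assms by (simp only: ideal'_adj)
qed (use assms in simp)

lemma wreg_map_power:
  assumes "ideal' J" "wreg J fs"
  shows "wreg J (map (\<lambda>f. f ^ Suc l) fs)"
  using assms
proof (induction fs arbitrary: J)
  case (Cons f fs)
  have "wreg (adj J f) (map (\<lambda>f. f ^ Suc l) fs)"
    using Cons by (auto intro: ideal'_adj)
  then have "wreg (adj J (f ^ Suc l)) (map (\<lambda>f. f ^ Suc l) fs)"
    using Cons.prems by (intro wreg_adj_power) auto
  then show ?case
    using Cons.prems nzd_power[of J f "Suc l"] by simp
qed simp

text \<open>The separation hypothesis replaces Nakayama's lemma, which only holds locally.\<close>

lemma wreg_swap:
  assumes "ideal' J" "wreg J [x, f]"
    and sep: "\<And>m. (\<And>k. m \<in> adj J (x ^ k)) \<Longrightarrow> m \<in> J"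
  shows "wreg J [f, x]"
proof -
  have nx: "nzd J x" and nf: "nzd (adj J x) f"
    using assms by auto
  have "nzd J f"
    unfolding nzd_def
  proof (intro allI impI)
    fix m assume m: "f * m \<in> J"
    \<comment> \<open>A factor \<open>x\<close> can be split off again and again: modulo
      \<open>J\<close>, \<open>m\<close> is a multiple of every power of \<open>x\<close>, with a
      cofactor that \<open>f\<close> still sends into \<open>J\<close>.\<close>
    have "\<exists>r. f * r \<in> J \<and> m - x ^ k * r \<in> J" for k
    proof (induction k)
      case 0
      then show ?case using m ideal'_0[OF assms(1)] by (intro exI[of _ m]) auto
    next
      case (Suc k)
      then obtain r where r: "f * r \<in> J" "m - x ^ k * r \<in> J" by blast
      then have "r \<in> adj J x" using nf subset_adj unfolding nzd_def by blast
      then obtain j s where j: "j \<in> J" "r = j + x * s" by (elim adjE)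
      have "x * (f * s) = f * r - f * j" using j by (simp add: algebra_simps)
      then have "x * (f * s) \<in> J"
        using j r assms(1) by (simp add: ideal'_diff ideal'_mult_left)
      then have s: "f * s \<in> J" using nx by (simp add: nzd_def)
      have "m - x ^ Suc k * s = (m - x ^ k * r) + x ^ k * j"
        using j by (simp add: algebra_simps)
      then have "m - x ^ Suc k * s \<in> J"
        using j r assms(1) by (simp only: ideal'_add ideal'_mult_left)
      with s show ?case by blast
    qed
    then obtain r where r: "m - x ^ k * r k \<in> J" for k by metis
    have "m \<in> adj J (x ^ k)" for k
      using adjI[OF r[of k], of "x ^ k" "r k"] by simp
    then show "m \<in> J" by (rule sep)
  qed
  moreover have "nzd (adj J f) x"
    unfolding nzd_def
  proof (intro allI impI)
    fix m assume "x * m \<in> adj J f"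
    then obtain j r where j: "j \<in> J" "x * m = j + f * r" by (elim adjE)
    have "- j + x * m \<in> adj J x" using j assms(1) by (intro adjI ideal'_uminus)
    then have "f * r \<in> adj J x" using j by simp
    then have "r \<in> adj J x" using nf by (simp add: nzd_def)
    then obtain i s where i: "i \<in> J" "r = i + x * s" by (elim adjE)
    have "x * (m - f * s) = j + f * i" using i j by (simp add: algebra_simps)
    also have "\<dots> \<in> J" using i j assms(1) by (simp add: ideal'_add ideal'_mult_left)
    finally have "m - f * s \<in> J" using nx by (simp add: nzd_def)
    then have "(m - f * s) + f * s \<in> adj J f" by (rule adjI)
    then show "m \<in> adj J f" by simp
  qed
  ultimately show ?thesis by simp
qed

text \<open>The element \<open>x\<close> moves right one position at a time by
  \<open>wreg_swap\<close>; hence the separation hypothesis for each initial segment.\<close>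

lemma wreg_rotate:
  assumes "ideal' J" "wreg J (x # fs)"
    and "\<And>i m. i < length fs \<Longrightarrow> (\<And>k. m \<in> adj (adjs J (take i fs)) (x ^ k)) \<Longrightarrow> m \<in> adjs J (take i fs)"
  shows "wreg J (fs @ [x])"
  using assms
proof (induction fs arbitrary: J)
  case (Cons f fs)
  have "wreg J [f, x]"
  proof (rule wreg_swap[OF Cons.prems(1)])
    show "wreg J [x, f]" using Cons.prems(2) by simp
    show "m \<in> J" if "\<And>k. m \<in> adj J (x ^ k)" for m
      using Cons.prems(3)[of 0 m] that by simp
  qed
  moreover have "wreg (adj J f) (fs @ [x])"
  proof (rule Cons.IH)
    show "ideal' (adj J f)" using Cons.prems(1) by (rule ideal'_adj)
    show "wreg (adj J f) (x # fs)"
      using Cons.prems(2) \<open>wreg J [f, x]\<close> by (simp add: adj_commute)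
    show "m \<in> adjs (adj J f) (take i fs)"
      if "i < length fs" "\<And>k. m \<in> adj (adjs (adj J f) (take i fs)) (x ^ k)" for i m
      using Cons.prems(3)[of "Suc i" m] that by simp
  qed
  ultimately show ?case by simp
qed simp

text \<open>A climb adjoins in each step a non-zero-divisor modulo the previous ideal. Chains of primes and
  regular sequences are climbs, and so are their concatenations.\<close>

inductive climb :: "nat \<Rightarrow> 'a::comm_ring_1 set \<Rightarrow> bool" where
  climb_0: "ideal' K \<Longrightarrow> climb 0 K"
| climb_Suc: "climb N J \<Longrightarrow> nzd J z \<Longrightarrow> ideal' K \<Longrightarrow> J \<subseteq> K \<Longrightarrow> z \<in> K \<Longrightarrow> climb (Suc N) K"

lemma climb_ideal': "climb N K \<Longrightarrow> ideal' K"
  by (auto elim: climb.cases)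

lemma climb_mono: "climb N J \<Longrightarrow> J \<subseteq> K \<Longrightarrow> ideal' K \<Longrightarrow> climb N K"
  by (erule climb.cases) (blast intro: climb_0 climb_Suc)+

section \<open>Chains of primes and regular sequences as climbs\<close>

lemma primeideal_iff:
  "primeideal (P :: 'a::comm_ring_1 set) ring_of_type_algebra \<longleftrightarrow>
    ideal' P \<and> 1 \<notin> P \<and> (\<forall>x y. x * y \<in> P \<longrightarrow> x \<in> P \<or> y \<in> P)"
  (is "?L \<longleftrightarrow> ?R")
proof
  assume ?L
  then interpret primeideal P ring_of_type_algebra .
  show ?R
    using is_ideal I_notcarr one_imp_carrier I_prime by auto
next
  assume ?R
  then show ?L
    by (intro primeidealI cring_from_type_algebra) auto
qed

lemma primeideal_imp_ideal': "primeideal (P :: 'a::comm_ring_1 set) ring_of_type_algebra \<Longrightarrow> ideal' P"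
  by (rule primeideal.axioms(1))

lemma primeideal_1: "primeideal (P :: 'a::comm_ring_1 set) ring_of_type_algebra \<Longrightarrow> 1 \<notin> P"
  using primeideal.I_notcarr[of P ring_of_type_algebra]
    ideal.one_imp_carrier[of P ring_of_type_algebra]
  by (auto dest: primeideal_imp_ideal')

lemma primeideal_nzd: "primeideal (P :: 'a::comm_ring_1 set) ring_of_type_algebra \<Longrightarrow> x \<notin> P \<Longrightarrow> nzd P x"
  using primeideal.I_prime[of P ring_of_type_algebra x] by (auto simp: nzd_def)

lemma climb_prime_chain:
  assumes "prime_chain ring_of_type_algebra C r" "climb N (C 0)"
  shows "climb (N + r) (C r)"
  using assms
proof (induction r)
  case (Suc r)
  then have 1: "climb (N + r) (C r)" by (simp add: prime_chain_def)
  from Suc.prems have C: "primeideal (C r) ring_of_type_algebra" "C r \<subset> C (Suc r)"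
    "primeideal (C (Suc r)) ring_of_type_algebra"
    by (auto simp: prime_chain_def)
  then obtain z where "z \<in> C (Suc r)" "z \<notin> C r" by blast
  with C show ?case
    using climb_Suc[OF 1 primeideal_nzd, of z "C (Suc r)"] primeideal_imp_ideal' by auto
qed simp

text \<open>Multiplication by \<open>u\<close> embeds R/(I : u) into R/I, so a non-zero-divisor on
  R/I remains one on R/(I : u). The climb thus continues through the colons by \<open>u\<close> of
  the ideals I + (g_1, ..., g_i).\<close>

lemma climb_wreg:
  assumes "ideal' I" "wreg I gs" "climb N (colon I u)"
  shows "climb (N + length gs) (colon (adjs I gs) u)"
  using assms
proof (induction gs arbitrary: I N)
  case (Cons g gs)
  have "nzd (colon I u) g"
    unfolding nzd_def colon_def mem_Collect_eq
  proof (intro allI impI)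
    fix m assume "u * (g * m) \<in> I"
    then have "g * (u * m) \<in> I" by (simp only: mult.left_commute)
    then show "u * m \<in> I" using Cons.prems(2) by (simp add: nzd_def)
  qed
  moreover have "colon I u \<subseteq> colon (adj I g) u"
    using subset_adj by (auto simp: colon_def)
  moreover have "g \<in> colon (adj I g) u"
    unfolding colon_def using Cons.prems(1) by (simp add: ideal'_mult_left ideal'_adj mem_adj)
  ultimately have "climb (Suc N) (colon (adj I g) u)"
    using Cons.prems by (intro climb_Suc[of N "colon I u" g] ideal'_colon ideal'_adj)
  then show ?case
    using Cons.IH[of "adj I g" "Suc N"] Cons.prems by (simp add: ideal'_adj)
qed simp

section \<open>Algebraic independence and the length of climbs\<close>

text \<open>Gaussian elimination: an equation with a non-zero coefficient is solved for one unknown,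
  which leaves one equation and one unknown fewer.\<close>

lemma homogeneous_system_nontrivial_solution:
  fixes c :: "'a \<Rightarrow> 'b \<Rightarrow> 'k::field"
  assumes "finite E" "finite A" "card E < card A"
  shows "\<exists>q. (\<exists>\<alpha>\<in>A. q \<alpha> \<noteq> 0) \<and> (\<forall>e\<in>E. (\<Sum>\<alpha>\<in>A. q \<alpha> * c \<alpha> e) = 0)"
  using assms
proof (induction E arbitrary: A c rule: finite_induct)
  case empty
  then obtain \<alpha> where "\<alpha> \<in> A" by fastforce
  then show ?case by (intro exI[of _ "\<lambda>_. 1"]) auto
next
  case (insert e E)
  show ?case
  proof (cases "\<forall>\<alpha>\<in>A. c \<alpha> e = 0")
    case True
    have "card E < card A" using insert.hyps insert.prems by simp
    with insert.IH[of A c] insert.prems obtain q where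
      "\<exists>\<alpha>\<in>A. q \<alpha> \<noteq> 0" "\<forall>e\<in>E. (\<Sum>\<alpha>\<in>A. q \<alpha> * c \<alpha> e) = 0" by blast
    with True show ?thesis by (intro exI[of _ q]) simp
  next
    case False
    then obtain \<beta> where \<beta>: "\<beta> \<in> A" "c \<beta> e \<noteq> 0" by blast
    \<comment> \<open>The coefficients after \<open>\<beta>\<close> has been eliminated by means of
      equation \<open>e\<close>.\<close>
    define c' where "c' \<alpha> e' = c \<alpha> e' - c \<alpha> e / c \<beta> e * c \<beta> e'" for \<alpha> e'
    have "card E < card (A - {\<beta>})" "finite (A - {\<beta>})"
      using insert.hyps insert.prems \<beta> by auto
    with insert.IH[of "A - {\<beta>}" c'] obtain q where
      q: "\<exists>\<alpha>\<in>A - {\<beta>}. q \<alpha> \<noteq> 0" "\<forall>e\<in>E. (\<Sum>\<alpha>\<in>A - {\<beta>}. q \<alpha> * c' \<alpha> e) = 0" by blast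
    define q' where "q' \<alpha> = (if \<alpha> = \<beta> then - (\<Sum>\<alpha>\<in>A - {\<beta>}. q \<alpha> * c \<alpha> e) / c \<beta> e else q \<alpha>)" for \<alpha>
    have q': "(\<Sum>\<alpha>\<in>A. q' \<alpha> * c \<alpha> e') = (\<Sum>\<alpha>\<in>A - {\<beta>}. q \<alpha> * c' \<alpha> e')" for e'
    proof -
      have "(\<Sum>\<alpha>\<in>A. q' \<alpha> * c \<alpha> e') = q' \<beta> * c \<beta> e' + (\<Sum>\<alpha>\<in>A - {\<beta>}. q' \<alpha> * c \<alpha> e')"
        using \<beta> insert.prems by (subst sum.remove[of _ \<beta>]) auto
      also have "(\<Sum>\<alpha>\<in>A - {\<beta>}. q' \<alpha> * c \<alpha> e') = (\<Sum>\<alpha>\<in>A - {\<beta>}. q \<alpha> * c \<alpha> e')"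
        by (intro sum.cong) (auto simp: q'_def)
      also have "q' \<beta> * c \<beta> e' = - (\<Sum>\<alpha>\<in>A - {\<beta>}. q \<alpha> * (c \<alpha> e / c \<beta> e * c \<beta> e'))"
        by (simp add: q'_def sum_distrib_right sum_distrib_left sum_divide_distrib mult_ac)
      also have "\<dots> + (\<Sum>\<alpha>\<in>A - {\<beta>}. q \<alpha> * c \<alpha> e') = (\<Sum>\<alpha>\<in>A - {\<beta>}. q \<alpha> * c' \<alpha> e')"
        by (simp add: c'_def right_diff_distrib sum_subtractf)
      finally show ?thesis .
    qed
    have "c' \<alpha> e = 0" for \<alpha> using \<beta> by (simp add: c'_def)
    then have "\<forall>e'\<in>insert e E. (\<Sum>\<alpha>\<in>A. q' \<alpha> * c \<alpha> e') = 0"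
      using q(2) by (simp add: q')
    moreover have "\<exists>\<alpha>\<in>A. q' \<alpha> \<noteq> 0"
      using q(1) by (auto simp: q'_def)
    ultimately show ?thesis by blast
  qed
qed

text \<open>Bounding each exponent instead of the total degree makes the count an exact power; lists
  let the first exponent be split off together with the first element of \<open>zs\<close>.\<close>

definition box :: "nat \<Rightarrow> nat \<Rightarrow> nat list set" where
  "box N M = {\<alpha>. set \<alpha> \<subseteq> {..M} \<and> length \<alpha> = N}"

lemma finite_box: "finite (box N M)"
  unfolding box_def by (rule finite_lists_length_eq) simp

lemma card_box: "card (box N M) = Suc M ^ N"
  unfolding box_def by (subst card_lists_length_eq) simp_all

lemma box_0: "box 0 M = {[]}"
  by (auto simp: box_def)

lemma sum_box_Suc: "(\<Sum>\<alpha>\<in>box (Suc N) M. f \<alpha>) = (\<Sum>a\<le>M. \<Sum>\<alpha>\<in>box N M. f (a # \<alpha>))"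
proof -
  have "box (Suc N) M = (\<lambda>(a, \<alpha>). a # \<alpha>) ` ({..M} \<times> box N M)"
    by (auto simp: box_def length_Suc_conv image_iff)
  then have "(\<Sum>\<alpha>\<in>box (Suc N) M. f \<alpha>) = (\<Sum>(a, \<alpha>)\<in>{..M} \<times> box N M. f (a # \<alpha>))"
    by (subst \<open>box (Suc N) M = _\<close>, subst sum.reindex) (auto simp: inj_on_def intro!: sum.cong)
  then show ?thesis by (simp add: sum.cartesian_product)
qed

definition mono_eval :: "'a::comm_ring_1 list \<Rightarrow> nat list \<Rightarrow> 'a" where
  "mono_eval zs \<alpha> = prod_list (map2 (^) zs \<alpha>)"

lemma mono_eval_simps [simp]:
  "mono_eval [] \<alpha> = 1" "mono_eval (z # zs) (a # \<alpha>) = z ^ a * mono_eval zs \<alpha>"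
  by (simp_all add: mono_eval_def)

abbreviation const :: "'k \<Rightarrow> ('n, 'k::field) mpoly" where
  "const c \<equiv> Poly_Mapping.single 0 c"

text \<open>Algebraic independence of the residues modulo \<open>J\<close>. For an ideal
  \<open>J\<close> it implies independence in the polynomial ring itself, because 0 lies in
  \<open>J\<close>.\<close>

definition indep :: "('n, 'k::field) mpoly set \<Rightarrow> ('n, 'k) mpoly list \<Rightarrow> bool" where
  "indep J zs \<longleftrightarrow> (\<forall>M q. (\<Sum>\<alpha>\<in>box (length zs) M. const (q \<alpha>) * mono_eval zs \<alpha>) \<in> J \<longrightarrow>
    (\<forall>\<alpha>\<in>box (length zs) M. q \<alpha> = 0))"

lemma indep_Nil:
  assumes "ideal' J" "1 \<notin> J" shows "indep J []"
  unfolding indep_def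
proof (intro allI impI ballI)
  fix M q \<alpha> assume "(\<Sum>\<alpha>\<in>box (length []) M. const (q \<alpha>) * mono_eval [] \<alpha>) \<in> J"
    and \<alpha>: "\<alpha> \<in> box (length ([] :: ('n, 'k) mpoly list)) M"
  then have "const (q []) \<in> J" by (simp add: box_0)
  then have *: "const (inverse (q [])) * const (q []) \<in> J" by (rule ideal'_mult_left[OF assms(1)])
  have "q [] = 0"
  proof (rule ccontr)
    assume "q [] \<noteq> 0"
    with * assms(2) show False by (simp add: mult_single)
  qed
  with \<alpha> show "q \<alpha> = 0" by (simp add: box_0)
qed

text \<open>Cancel the lowest power of \<open>z\<close> in a relation and reduce modulo the larger ideal.\<close>

lemma indep_Cons:
  assumes "ideal' J" "nzd J z" "ideal' K" "J \<subseteq> K" "z \<in> K" "indep K zs"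
  shows "indep J (z # zs)"
  unfolding indep_def
proof (intro allI impI)
  fix M q
  let ?N = "length zs"
  define S where "S a = (\<Sum>\<alpha>\<in>box ?N M. const (q (a # \<alpha>)) * mono_eval zs \<alpha>)" for a
  assume "(\<Sum>\<alpha>\<in>box (length (z # zs)) M. const (q \<alpha>) * mono_eval (z # zs) \<alpha>) \<in> J"
  then have sum: "(\<Sum>a\<le>M. z ^ a * S a) \<in> J"
    by (simp add: sum_box_Suc S_def sum_distrib_left mult_ac)
  have S: "S a = 0" if "a \<le> M" for a
    using that
  proof (induction a rule: less_induct)
    case (less a)
    have "(\<Sum>b\<le>M. z ^ b * S b) = (\<Sum>b\<in>{a..M}. z ^ b * S b)"
      by (rule sum.mono_neutral_right) (use less in auto)
    also have "\<dots> = z ^ a * S a + (\<Sum>b\<in>{Suc a..M}. z ^ b * S b)"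
      using less.prems by (simp add: sum.atLeast_Suc_atMost)
    also have "(\<Sum>b\<in>{Suc a..M}. z ^ b * S b) = z ^ a * (z * (\<Sum>b\<in>{Suc a..M}. z ^ (b - Suc a) * S b))"
    proof -
      have "z ^ b * S b = z ^ a * (z * (z ^ (b - Suc a) * S b))" if "b \<in> {Suc a..M}" for b
      proof -
        have "b = a + Suc (b - Suc a)" using that by simp
        then have "z ^ b = z ^ a * (z * z ^ (b - Suc a))" by (metis power_Suc power_add)
        then show ?thesis by (simp add: mult.assoc)
      qed
      then show ?thesis by (simp add: sum_distrib_left)
    qed
    finally have "z ^ a * (S a + z * (\<Sum>b\<in>{Suc a..M}. z ^ (b - Suc a) * S b)) \<in> J"
      using sum by (simp add: distrib_left)
    then have "S a + z * (\<Sum>b\<in>{Suc a..M}. z ^ (b - Suc a) * S b) \<in> K"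
      using nzd_power[OF assms(2), of a] assms(4) by (auto simp: nzd_def)
    then have "S a \<in> K"
      using assms(3,5) ideal'_mult_right ideal'_add_cancel by blast
    \<comment> \<open>Independence modulo \<open>K\<close> turns membership of \<open>S a\<close> in
      \<open>K\<close> into the vanishing of all its coefficients, so \<open>S a\<close> is exactly
      0 and the lowest power of \<open>z\<close> moves up.\<close>
    then have "\<forall>\<alpha>\<in>box ?N M. q (a # \<alpha>) = 0"
      using assms(6)[unfolded indep_def, rule_format, of "\<lambda>\<alpha>. q (a # \<alpha>)" M] unfolding S_def by blast
    then show ?case by (simp add: S_def)
  qed
  have "q (a # \<alpha>) = 0" if "a \<le> M" "\<alpha> \<in> box ?N M" for a \<alpha>
  proof -
    have "S a \<in> K" using S[OF that(1)] ideal'_0[OF assms(3)] by simp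
    then show ?thesis
      using assms(6)[unfolded indep_def, rule_format, of "\<lambda>\<alpha>. q (a # \<alpha>)" M] that unfolding S_def by blast
  qed
  then show "\<forall>\<alpha>\<in>box (length (z # zs)) M. q \<alpha> = 0"
    by (auto simp: box_def length_Suc_conv)
qed

text \<open>The climb is read from its top downwards: each witness \<open>z\<close> is put in front
  of a list independent modulo the ideal above it. The list \<open>ws\<close> holds the witnesses
  already passed.\<close>

lemma climb_indep:
  fixes K :: "('n, 'k::field) mpoly set"
  assumes "climb N K" "indep K ws"
  shows "\<exists>(J :: ('n, 'k) mpoly set) zs. ideal' J \<and> length zs = N + length ws \<and> indep J zs"
  using assms
proof (induction arbitrary: ws rule: climb.induct)
  case (climb_0 K)
  then have "ideal' K \<and> length ws = 0 + length ws \<and> indep K ws" by simp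
  then show ?case by blast
next
  case (climb_Suc N J z K)
  have "indep J (z # ws)"
    using climb_Suc by (intro indep_Cons[of J z K]) (auto dest: climb_ideal')
  from climb_Suc.IH[OF this] show ?case by simp
qed

section \<open>Counting exponents\<close>

definition exps_le :: "nat \<Rightarrow> ('n::finite \<Rightarrow>\<^sub>0 nat) set" where
  "exps_le B = {e. \<forall>i. Poly_Mapping.lookup e i \<le> B}"

lemma card_exps_le: "finite (exps_le B :: ('n::finite \<Rightarrow>\<^sub>0 nat) set)"
  "card (exps_le B :: ('n \<Rightarrow>\<^sub>0 nat) set) \<le> Suc B ^ CARD('n)"
proof -
  let ?F = "UNIV \<rightarrow>\<^sub>E {..B} :: ('n \<Rightarrow> nat) set"
  have inj: "inj_on Poly_Mapping.lookup (exps_le B :: ('n \<Rightarrow>\<^sub>0 nat) set)"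
    by (auto simp: inj_on_def intro: poly_mapping_eqI)
  have sub: "Poly_Mapping.lookup ` (exps_le B :: ('n \<Rightarrow>\<^sub>0 nat) set) \<subseteq> ?F"
    by (auto simp: exps_le_def)
  have fin: "finite ?F" by (intro finite_PiE) auto
  show "finite (exps_le B :: ('n::finite \<Rightarrow>\<^sub>0 nat) set)"
    using finite_subset[OF sub fin] inj by (rule finite_imageD)
  have "card (exps_le B :: ('n \<Rightarrow>\<^sub>0 nat) set) \<le> card ?F"
    using card_inj_on_le[OF inj sub fin] .
  also have "\<dots> = Suc B ^ CARD('n)" by (subst card_PiE) auto
  finally show "card (exps_le B :: ('n \<Rightarrow>\<^sub>0 nat) set) \<le> Suc B ^ CARD('n)" .
qed

lemma exps_le_mult:
  fixes p q :: "('n::finite, 'k::field) mpoly"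
  assumes "Poly_Mapping.keys p \<subseteq> exps_le A" "Poly_Mapping.keys q \<subseteq> exps_le B"
  shows "Poly_Mapping.keys (p * q) \<subseteq> exps_le (A + B)"
proof
  fix e assume "e \<in> Poly_Mapping.keys (p * q)"
  then obtain x y where "e = x + y" "x \<in> Poly_Mapping.keys p" "y \<in> Poly_Mapping.keys q"
    using keys_mult[of p q] by blast
  with assms show "e \<in> exps_le (A + B)"
    by (force simp: exps_le_def lookup_add intro: add_mono)
qed

lemma exps_le_power:
  fixes p :: "('n::finite, 'k::field) mpoly"
  assumes "Poly_Mapping.keys p \<subseteq> exps_le A"
  shows "Poly_Mapping.keys (p ^ k) \<subseteq> exps_le (k * A)"
proof (induction k)
  case 0
  then show ?case by (auto simp: exps_le_def)
next
  case (Suc k)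
  then show ?case using exps_le_mult[OF assms Suc] by simp
qed

lemma exps_le_mono: "A \<le> B \<Longrightarrow> exps_le A \<subseteq> exps_le B"
  by (auto simp: exps_le_def intro: order_trans)

lemma exps_le_mono_eval:
  fixes zs :: "('n::finite, 'k::field) mpoly list"
  assumes "\<forall>z\<in>set zs. Poly_Mapping.keys z \<subseteq> exps_le D" "\<alpha> \<in> box (length zs) M"
  shows "Poly_Mapping.keys (mono_eval zs \<alpha>) \<subseteq> exps_le (length zs * (M * D))"
  using assms
proof (induction zs arbitrary: \<alpha>)
  case Nil
  then show ?case by (auto simp: exps_le_def)
next
  case (Cons z zs)
  then obtain a \<beta> where \<alpha>: "\<alpha> = a # \<beta>" "a \<le> M" "\<beta> \<in> box (length zs) M"
    by (auto simp: box_def length_Suc_conv)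
  have "Poly_Mapping.keys (z ^ a) \<subseteq> exps_le (M * D)"
    using exps_le_power[of z D a] exps_le_mono[of "a * D" "M * D"] Cons.prems \<alpha>(2) by force
  then show ?case
    using exps_le_mult[of "z ^ a" "M * D" "mono_eval zs \<beta>" "length zs * (M * D)"] Cons \<alpha> by simp
qed

lemma exps_le_bound:
  fixes zs :: "('n::finite, 'k::field) mpoly list"
  obtains D where "\<forall>z\<in>set zs. Poly_Mapping.keys z \<subseteq> exps_le D"
proof -
  have "\<exists>D. \<forall>z\<in>set zs. Poly_Mapping.keys z \<subseteq> exps_le D"
  proof
    let ?S = "\<Union>z\<in>set zs. \<Union>e\<in>Poly_Mapping.keys z. Poly_Mapping.lookup e ` UNIV"
    have "finite ?S" by auto
    then show "\<forall>z\<in>set zs. Poly_Mapping.keys z \<subseteq> exps_le (Max ?S)"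
      unfolding exps_le_def by (intro ballI subsetI CollectI allI Max_ge) auto
  qed
  then show ?thesis using that by blast
qed

text \<open>With exponents up to \<open>M\<close>, the \<open>N\<close> elements have
  \<open>(M + 1)^N\<close> power products, whose terms have exponents in a box of at most
  \<open>(N M D + 1)^n\<close> points. For \<open>N > n\<close> and a large \<open>M\<close> they
  are linearly dependent.\<close>

lemma indep_length_le:
  fixes zs :: "('n::finite, 'k::field) mpoly list"
  assumes "ideal' J" "indep J zs"
  shows "length zs \<le> CARD('n)"
proof (rule ccontr)
  let ?n = "CARD('n)" and ?N = "length zs"
  assume "\<not> ?N \<le> ?n"
  then have N: "Suc ?n \<le> ?N" by simp
  obtain D where D: "\<forall>z\<in>set zs. Poly_Mapping.keys z \<subseteq> exps_le D" by (rule exps_le_bound)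
  \<comment> \<open>With this value
    \<open>(N M D + 1)^n <= ((M + 1) (N D + 1))^n = (M + 1)^n M\<close>, which is below
    \<open>(M + 1)^(n+1)\<close>.\<close>
  define M where "M = Suc (?N * D) ^ ?n"
  let ?E = "exps_le (?N * (M * D)) :: ('n \<Rightarrow>\<^sub>0 nat) set"
  have "card ?E \<le> Suc (?N * (M * D)) ^ ?n" by (rule card_exps_le)
  also have "\<dots> \<le> (Suc M * Suc (?N * D)) ^ ?n" by (intro power_mono) (auto simp: algebra_simps)
  also have "\<dots> = Suc M ^ ?n * M" by (simp only: M_def power_mult_distrib)
  also have "\<dots> < Suc M ^ ?n * Suc M" by simp
  also have "\<dots> = Suc M ^ Suc ?n" by simp
  also have "\<dots> \<le> Suc M ^ ?N" using N by (intro power_increasing) auto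
  also have "\<dots> = card (box ?N M)" by (simp add: card_box)
  finally have "card ?E < card (box ?N M)" .
  from homogeneous_system_nontrivial_solution[OF card_exps_le(1) finite_box this,
      of "\<lambda>\<alpha> e. Poly_Mapping.lookup (mono_eval zs \<alpha>) e"]
  obtain q where q: "\<exists>\<alpha>\<in>box ?N M. q \<alpha> \<noteq> 0"
    "\<forall>e\<in>?E. (\<Sum>\<alpha>\<in>box ?N M. q \<alpha> * Poly_Mapping.lookup (mono_eval zs \<alpha>) e) = 0" by blast
  have l: "Poly_Mapping.lookup (const c * p) e = c * Poly_Mapping.lookup p e" for c e and p :: "('n, 'k) mpoly"
    by (simp flip: mult_map_scale_conv_mult add: map.rep_eq when_def)
  have "(\<Sum>\<alpha>\<in>box ?N M. const (q \<alpha>) * mono_eval zs \<alpha>) = 0"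
  proof (rule poly_mapping_eqI)
    fix e
    show "Poly_Mapping.lookup (\<Sum>\<alpha>\<in>box ?N M. const (q \<alpha>) * mono_eval zs \<alpha>) e = Poly_Mapping.lookup 0 e"
    proof (cases "e \<in> ?E")
      case True
      then show ?thesis using q(2) by (simp add: lookup_sum l)
    next
      case False
      then have "Poly_Mapping.lookup (mono_eval zs \<alpha>) e = 0" if "\<alpha> \<in> box ?N M" for \<alpha>
        using exps_le_mono_eval[OF D that] by (metis in_keys_iff subsetD)
      then show ?thesis by (simp add: lookup_sum l)
    qed
  qed
  then have "(\<Sum>\<alpha>\<in>box ?N M. const (q \<alpha>) * mono_eval zs \<alpha>) \<in> J"
    using ideal'_0[OF assms(1)] by simp
  with assms(2) q(1) show False unfolding indep_def by blast
qed

theorem climb_le_card: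
  fixes K :: "('n::finite, 'k::field) mpoly set"
  assumes "climb N K" "1 \<notin> K"
  shows "N \<le> CARD('n)"
  using climb_indep[OF assms(1) indep_Nil[OF climb_ideal'[OF assms(1)] assms(2)]]
  by (auto dest: indep_length_le)

section \<open>Monomial ideals\<close>

definition restr :: "'e set \<Rightarrow> ('e \<Rightarrow>\<^sub>0 'k::zero) \<Rightarrow> 'e \<Rightarrow>\<^sub>0 'k" where
  "restr A p = Abs_poly_mapping (\<lambda>e. Poly_Mapping.lookup p e when e \<in> A)"

lemma lookup_restr: "Poly_Mapping.lookup (restr A p) e = (Poly_Mapping.lookup p e when e \<in> A)"
proof -
  have "finite {e. (Poly_Mapping.lookup p e when e \<in> A) \<noteq> 0}"
    by (rule finite_subset[OF _ finite_lookup[of p]]) auto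
  then show ?thesis by (simp add: restr_def)
qed

lemma keys_restr: "Poly_Mapping.keys (restr A p) = Poly_Mapping.keys p \<inter> A"
  by (auto simp: in_keys_iff lookup_restr)

lemma restr_add: "restr A (p + q) = restr A p + restr A (q :: 'e \<Rightarrow>\<^sub>0 'k::monoid_add)"
  by (rule poly_mapping_eqI) (simp add: lookup_restr lookup_add when_def)

lemma restr_split: "p = restr A p + restr (- A) (p :: 'e \<Rightarrow>\<^sub>0 'k::monoid_add)"
  by (rule poly_mapping_eqI) (simp add: lookup_restr lookup_add when_def)

lemma restr_id: "Poly_Mapping.keys p \<subseteq> A \<Longrightarrow> restr A p = p"
  by (rule poly_mapping_eqI) (auto simp: lookup_restr when_def in_keys_iff)

lemma restr_0: "Poly_Mapping.keys p \<inter> A = {} \<Longrightarrow> restr A p = 0"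
  by (rule poly_mapping_eqI) (auto simp: lookup_restr when_def in_keys_iff)

definition upset :: "'e::monoid_add set \<Rightarrow> bool" where
  "upset E \<longleftrightarrow> (\<forall>e\<in>E. \<forall>e'. e' + e \<in> E)"

text \<open>For an upset \<open>E\<close> this is the monomial ideal with exponent set
  \<open>E\<close>. Membership through supports turns colons by and sums with a monomial into
  operations on exponent sets.\<close>

definition mideal :: "('n \<Rightarrow>\<^sub>0 nat) set \<Rightarrow> ('n, 'k::field) mpoly set" where
  "mideal E = {p. Poly_Mapping.keys p \<subseteq> E}"

lemma ideal'_mideal:
  assumes "upset E" shows "ideal' (mideal E :: ('n, 'k::field) mpoly set)"
proof (rule ideal'I)
  fix x y :: "('n, 'k) mpoly" assume "x \<in> mideal E" "y \<in> mideal E"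
  then show "x + y \<in> mideal E"
    using keys_add[of x y] by (auto simp: mideal_def)
next
  fix x r :: "('n, 'k) mpoly" assume "x \<in> mideal E"
  then show "r * x \<in> mideal E"
    using keys_mult[of r x] assms by (fastforce simp: mideal_def upset_def)
qed (simp add: mideal_def)

lemma lookup_monomial_mult:
  "Poly_Mapping.lookup (monomial c * p) (c + e) = Poly_Mapping.lookup (p :: ('n, 'k::field) mpoly) e"
  by (simp add: monomial_def lookup_mult lookup_single when_mult)

lemma keys_monomial: "Poly_Mapping.keys (monomial c :: ('n, 'k::field) mpoly) = {c}"
  by (simp add: monomial_def)

lemma keys_monomial_mult:
  "Poly_Mapping.keys (monomial c * p) = (+) c ` Poly_Mapping.keys (p :: ('n, 'k::field) mpoly)"
proof
  show "Poly_Mapping.keys (monomial c * p) \<subseteq> (+) c ` Poly_Mapping.keys p"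
    using keys_mult[of "monomial c" p] by (auto simp: keys_monomial)
  show "(+) c ` Poly_Mapping.keys p \<subseteq> Poly_Mapping.keys (monomial c * p)"
    by (auto simp: in_keys_iff lookup_monomial_mult)
qed

lemma monomial_add: "monomial (c + e) = monomial c * (monomial e :: ('n, 'k::field) mpoly)"
  by (simp add: monomial_def mult_single)

lemma monomial_0: "monomial 0 = (1 :: ('n, 'k::field) mpoly)"
  by (simp add: monomial_def)

lemma monomial_in_mideal [simp]: "monomial c \<in> mideal E \<longleftrightarrow> c \<in> E"
  by (simp add: mideal_def keys_monomial)

lemma one_in_mideal [simp]: "1 \<in> mideal E \<longleftrightarrow> 0 \<in> E"
  by (simp flip: monomial_0)

lemma mideal_mono: "E \<subseteq> E' \<Longrightarrow> mideal E \<subseteq> mideal E'"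
  by (auto simp: mideal_def)

lemma mideal_least:
  fixes K :: "('n, 'k::field) mpoly set"
  assumes "ideal' K" "\<And>e. e \<in> E \<Longrightarrow> monomial e \<in> K"
  shows "mideal E \<subseteq> K"
proof
  fix p :: "('n, 'k) mpoly" assume p: "p \<in> mideal E"
  have "(\<Sum>e\<in>Poly_Mapping.keys p. const (Poly_Mapping.lookup p e) * monomial e) \<in> K"
    using p assms by (intro ideal'_sum ideal'_mult_left) (auto simp: mideal_def)
  also have "(\<Sum>e\<in>Poly_Mapping.keys p. const (Poly_Mapping.lookup p e) * monomial e) = p"
    by (rule poly_mapping_eqI)
      (auto simp: monomial_def mult_single lookup_sum lookup_single when_def in_keys_iff)
  finally show "p \<in> K" .
qed

lemma colon_mideal:
  "colon (mideal E) (monomial c) = (mideal {e. c + e \<in> E} :: ('n, 'k::field) mpoly set)"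
  by (auto simp: colon_def mideal_def keys_monomial_mult)

lemma adj_mideal:
  assumes "upset E"
  shows "adj (mideal E) (monomial c) = (mideal (E \<union> range ((+) c)) :: ('n, 'k::field) mpoly set)"
proof
  have "upset (E \<union> range ((+) c))"
    using assms by (auto simp: upset_def) (metis add.left_commute rangeI)
  then show "adj (mideal E) (monomial c) \<subseteq> (mideal (E \<union> range ((+) c)) :: ('n, 'k) mpoly set)"
    by (intro adj_least ideal'_mideal mideal_mono) (auto simp: image_iff intro: exI[of _ 0])
  show "mideal (E \<union> range ((+) c)) \<subseteq> (adj (mideal E) (monomial c) :: ('n, 'k) mpoly set)"
  proof (rule mideal_least)
    show I: "ideal' (adj (mideal E) (monomial c) :: ('n, 'k) mpoly set)"
      using assms by (intro ideal'_adj ideal'_mideal)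
    fix e assume "e \<in> E \<union> range ((+) c)"
    then show "monomial e \<in> (adj (mideal E) (monomial c) :: ('n, 'k) mpoly set)"
    proof
      assume "e \<in> E"
      then have "monomial e \<in> (mideal E :: ('n, 'k) mpoly set)" by simp
      then show ?thesis using subset_adj by blast
    next
      assume "e \<in> range ((+) c)"
      then obtain e' where "e = c + e'" by blast
      then show ?thesis
        using ideal'_mult_right[OF I mem_adj[OF ideal'_mideal[OF assms]]] by (simp add: monomial_add)
    qed
  qed
qed

section \<open>Prime ideals generated by variables\<close>

definition prime_exps :: "'n set \<Rightarrow> ('n \<Rightarrow>\<^sub>0 nat) set" where
  "prime_exps F = {e. \<exists>i\<in>F. 0 < Poly_Mapping.lookup e i}"

abbreviation var_ideal :: "'n set \<Rightarrow> ('n, 'k::field) mpoly set" where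
  "var_ideal F \<equiv> mideal (prime_exps F)"

lemma upset_prime_exps: "upset (prime_exps F)"
  by (auto simp: upset_def prime_exps_def lookup_add)

lemmas ideal'_var_ideal = ideal'_mideal[OF upset_prime_exps]

lemma var_in_var_ideal [simp]: "var i \<in> var_ideal F \<longleftrightarrow> i \<in> F"
  by (auto simp: var_def prime_exps_def lookup_single when_def)

lemma prime_exps_mono: "F \<subseteq> G \<Longrightarrow> prime_exps F \<subseteq> prime_exps G"
  by (auto simp: prime_exps_def)

lemma range_plus_single:
  "range ((+) (Poly_Mapping.single i (1::nat))) = {e. 0 < Poly_Mapping.lookup e (i :: 'n)}"
proof
  show "range ((+) (Poly_Mapping.single i (1::nat))) \<subseteq> {e. 0 < Poly_Mapping.lookup e i}"
    by (auto simp: lookup_add)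
  show "{e. 0 < Poly_Mapping.lookup e i} \<subseteq> range ((+) (Poly_Mapping.single i (1::nat)))"
  proof
    fix e :: "'n \<Rightarrow>\<^sub>0 nat" assume "e \<in> {e. 0 < Poly_Mapping.lookup e i}"
    then have "e = Poly_Mapping.single i 1 + (e - Poly_Mapping.single i 1)"
      by (intro poly_mapping_eqI) (auto simp: lookup_add lookup_minus lookup_single when_def)
    then show "e \<in> range ((+) (Poly_Mapping.single i 1))" by blast
  qed
qed

lemma lookup_posE:
  assumes "0 < Poly_Mapping.lookup e (i :: 'n)"
  obtains e' where "e = Poly_Mapping.single i (1::nat) + e'"
proof -
  have "e \<in> range ((+) (Poly_Mapping.single i (1::nat)))"
    unfolding range_plus_single using assms by simp
  then show ?thesis using that by blast
qed

lemma adj_var_ideal: "adj (var_ideal F) (var i) = var_ideal (insert i F)"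
  unfolding var_def adj_mideal[OF upset_prime_exps] range_plus_single
  by (rule arg_cong[of _ _ mideal]) (auto simp: prime_exps_def)

text \<open>Terms involving a variable of \<open>F\<close> can be discarded. The product of the
  remaining parts is free of these variables and still lies in the ideal, so it is 0, and
  polynomials over a field have no zero divisors.\<close>

lemma primeideal_var_ideal:
  "primeideal (var_ideal F :: ('n::linorder, 'k::field) mpoly set) poly_ring"
  unfolding primeideal_iff
proof (intro conjI allI impI)
  show "ideal' (var_ideal F :: ('n, 'k) mpoly set)" by (rule ideal'_var_ideal)
  show "1 \<notin> (var_ideal F :: ('n, 'k) mpoly set)" by (simp add: prime_exps_def)
  fix p q :: "('n, 'k) mpoly" assume pq: "p * q \<in> var_ideal F"
  let ?A = "- prime_exps F"
  define p0 where "p0 = restr ?A p"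
  define q0 where "q0 = restr ?A q"
  define p1 where "p1 = restr (prime_exps F) p"
  define q1 where "q1 = restr (prime_exps F) q"
  have p: "p = p1 + p0" unfolding p1_def p0_def by (rule restr_split)
  have q: "q = q1 + q0" unfolding q1_def q0_def by (rule restr_split)
  have p1: "p1 \<in> var_ideal F" and q1: "q1 \<in> var_ideal F"
    by (simp_all add: p1_def q1_def mideal_def keys_restr)
  have "p0 * q0 = p * q - (p1 * q + p0 * q1)" by (simp add: p q algebra_simps)
  also have "\<dots> \<in> var_ideal F"
    using pq p1 q1 ideal'_var_ideal
    by (intro ideal'_diff ideal'_add) (blast intro: ideal'_mult_left ideal'_mult_right)+
  finally have "Poly_Mapping.keys (p0 * q0) \<subseteq> prime_exps F" by (simp add: mideal_def)
  moreover have "Poly_Mapping.keys (p0 * q0) \<subseteq> ?A"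
    using keys_mult[of p0 q0]
    by (fastforce simp: p0_def q0_def keys_restr prime_exps_def lookup_add)
  ultimately have "Poly_Mapping.keys (p0 * q0) = {}" by blast
  then have "p0 * q0 = 0" by (simp only: keys_eq_empty)
  then have "p0 = 0 \<or> q0 = 0" by simp
  then show "p \<in> var_ideal F \<or> q \<in> var_ideal F"
    using p q p1 q1 by auto
qed

lemma nzd_var_ideal: "i \<notin> F \<Longrightarrow> nzd (var_ideal F :: ('n::linorder, 'k::field) mpoly set) (var i)"
  by (rule primeideal_nzd[OF primeideal_var_ideal]) simp

lemma climb_var_ideal:
  assumes "finite F"
  shows "climb (card F) (var_ideal F :: ('n::linorder, 'k::field) mpoly set)"
  using assms
proof (induction F rule: finite_induct)
  case (insert i F)
  have "var_ideal F \<subseteq> (var_ideal (insert i F) :: ('n, 'k) mpoly set)"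
    by (intro mideal_mono prime_exps_mono subset_insertI)
  then show ?case
    using climb_Suc[OF insert.IH nzd_var_ideal[of i F] ideal'_var_ideal[of "insert i F"]] insert.hyps
    by simp
qed (simp add: climb_0 ideal'_var_ideal)

section \<open>Elementary symmetric polynomials\<close>

definition edeg :: "('n::finite \<Rightarrow>\<^sub>0 nat) \<Rightarrow> nat" where
  "edeg e = (\<Sum>j\<in>UNIV. Poly_Mapping.lookup e j)"

lemma edeg_eq_0_iff: "edeg e = 0 \<longleftrightarrow> e = 0"
  by (auto simp: edeg_def intro: poly_mapping_eqI)

lemma edeg_add: "edeg (e + e') = edeg e + edeg e'"
  by (simp add: edeg_def lookup_add sum.distrib)

text \<open>For ideals this is homogeneity, expressed by truncations.\<close>

definition graded :: "('n::finite, 'k::field) mpoly set \<Rightarrow> bool" where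
  "graded J \<longleftrightarrow> (\<forall>p\<in>J. \<forall>d. restr {e. edeg e < d} p \<in> J)"

lemma graded_mideal: "graded (mideal E)"
  by (auto simp: graded_def mideal_def keys_restr)

text \<open>Multiplication by a form of degree \<open>\<delta>\<close> shifts degrees. For
  \<open>d < \<delta>\<close> the truncated difference is 0, and both sides vanish.\<close>

lemma restr_homogeneous_mult:
  fixes f r :: "('n::finite, 'k::field) mpoly"
  assumes "Poly_Mapping.keys f \<subseteq> {e. edeg e = \<delta>}"
  shows "restr {e. edeg e < d} (f * r) = f * restr {e. edeg e < d - \<delta>} r"
proof -
  let ?A = "{e. edeg e < d - \<delta>} :: ('n \<Rightarrow>\<^sub>0 nat) set"
  have "f * r = f * restr ?A r + f * restr (- ?A) r"
    using restr_split[of r ?A] by (simp flip: distrib_left)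
  moreover have "restr {e. edeg e < d} (f * restr ?A r) = f * restr ?A r"
    using keys_mult[of f "restr ?A r"] assms
    by (intro restr_id) (fastforce simp: keys_restr edeg_add)
  moreover have "restr {e. edeg e < d} (f * restr (- ?A) r) = 0"
    using keys_mult[of f "restr (- ?A) r"] assms
    by (intro restr_0) (fastforce simp: keys_restr edeg_add)
  ultimately show ?thesis by (simp add: restr_add)
qed

lemma graded_adj:
  assumes "graded J" "Poly_Mapping.keys f \<subseteq> {e. edeg e = \<delta>}"
  shows "graded (adj J f)"
  unfolding graded_def
proof (intro ballI allI)
  fix p d assume "p \<in> adj J f"
  then obtain j r where "j \<in> J" "p = j + f * r" by (elim adjE)
  with assms show "restr {e. edeg e < d} p \<in> adj J f"
    by (auto simp: restr_add restr_homogeneous_mult graded_def intro: adjI)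
qed

lemma graded_adjs:
  assumes "graded J" "\<And>f. f \<in> set fs \<Longrightarrow> \<exists>\<delta>. Poly_Mapping.keys f \<subseteq> {e. edeg e = \<delta>}"
  shows "graded (adjs J fs)"
  using assms
proof (induction fs arbitrary: J)
  case (Cons f fs)
  obtain \<delta> where "Poly_Mapping.keys f \<subseteq> {e. edeg e = \<delta>}"
    using Cons.prems(2)[of f] by auto
  with Cons show ?case by (auto intro: graded_adj)
qed simp

lemma edeg_bounded:
  obtains L where "\<forall>e\<in>Poly_Mapping.keys (p :: ('n::finite, 'k::field) mpoly). edeg e < L"
proof
  show "\<forall>e\<in>Poly_Mapping.keys p. edeg e < Suc (Max (edeg ` Poly_Mapping.keys p))"
    by (auto intro: le_imp_less_Suc)
qed

text \<open>The ideal \<open>mideal (order_exps L)\<close> is the \<open>L\<close>-th power of the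
  irrelevant ideal.\<close>

definition order_exps :: "nat \<Rightarrow> ('n::finite \<Rightarrow>\<^sub>0 nat) set" where
  "order_exps L = {e. L \<le> edeg e}"

lemma upset_order_exps: "upset (order_exps L)"
  by (auto simp: upset_def order_exps_def edeg_add)

lemma power_in_order_ideal:
  fixes f :: "('n::finite, 'k::field) mpoly"
  assumes "f \<in> mideal (order_exps 1)"
  shows "f ^ L \<in> mideal (order_exps L)"
proof (induction L)
  case 0
  then show ?case by (auto simp: mideal_def order_exps_def)
next
  case (Suc L)
  then show ?case
    using keys_mult[of f "f ^ L"] assms
    by (fastforce simp: mideal_def order_exps_def edeg_add)
qed

lemma edeg_single: "edeg (Poly_Mapping.single i k) = k"
  by (simp add: edeg_def lookup_single when_def)

lemma var_ideal_UNIV: "var_ideal UNIV = (mideal (order_exps 1) :: ('n::finite, 'k::field) mpoly set)"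
  by (rule arg_cong[of _ _ mideal])
    (auto simp: prime_exps_def order_exps_def edeg_def Suc_le_eq sum_pos2 neq0_conv[symmetric] simp del: neq0_conv)

text \<open>A graded form of Krull's intersection theorem: \<open>x^L r\<close> has no terms of
  degree below \<open>L\<close>, so for \<open>L\<close> above the degree of \<open>m\<close>,
  truncating \<open>m = j + x^L r\<close> exhibits \<open>m\<close> as a truncation of
  \<open>j\<close>.\<close>

lemma graded_separated:
  fixes J :: "('n::finite, 'k::field) mpoly set"
  assumes "ideal' J" "graded J" "x \<in> mideal (order_exps 1)" "\<And>k. m \<in> adj J (x ^ k)"
  shows "m \<in> J"
proof -
  obtain L where L: "\<forall>e\<in>Poly_Mapping.keys m. edeg e < L" by (rule edeg_bounded)
  obtain j r where j: "j \<in> J" "m = j + x ^ L * r" using assms(4)[of L] by (elim adjE)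
  have "x ^ L * r \<in> mideal (order_exps L)"
    using assms(3) by (intro ideal'_mult_right ideal'_mideal upset_order_exps power_in_order_ideal)
  then have "restr {e. edeg e < L} (x ^ L * r) = 0"
    by (intro restr_0) (auto simp: mideal_def order_exps_def)
  moreover have "restr {e. edeg e < L} m = m" using L by (intro restr_id) auto
  ultimately have "m = restr {e. edeg e < L} j" using j by (simp add: restr_add)
  then show ?thesis using j assms(2) by (auto simp: graded_def)
qed

section \<open>Regularity of the elementary symmetric polynomials\<close>

definition indicator_exp :: "'n::finite set \<Rightarrow> 'n \<Rightarrow>\<^sub>0 nat" where
  "indicator_exp A = (\<Sum>i\<in>A. Poly_Mapping.single i 1)"

definition esym :: "nat \<Rightarrow> ('n::finite, 'k::field) mpoly" where
  "esym j = (\<Sum>A\<in>{A. card A = j}. monomial (indicator_exp A))"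

lemma lookup_indicator_exp: "Poly_Mapping.lookup (indicator_exp A) i = (if i \<in> A then 1 else 0)"
  by (simp add: indicator_exp_def lookup_sum lookup_single when_def)

lemma edeg_indicator_exp: "edeg (indicator_exp A) = card A"
  unfolding edeg_def lookup_indicator_exp by (subst sum.If_cases) simp_all

lemma keys_esym: "Poly_Mapping.keys (esym j :: ('n::finite, 'k::field) mpoly) \<subseteq> {e. edeg e = j}"
  unfolding esym_def using keys_sum by (force simp: keys_monomial edeg_indicator_exp)

lemma esym_in_order_ideal: "1 \<le> j \<Longrightarrow> esym j \<in> mideal (order_exps 1)"
  using keys_esym[of j] by (auto simp: mideal_def order_exps_def)

text \<open>Every other set of the same size has an element outside \<open>S\<close>, so its
  monomial vanishes modulo the variables there.\<close>

lemma esym_cong: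
  "esym (card S) - monomial (indicator_exp S) \<in> (var_ideal (- S) :: ('n::finite, 'k::field) mpoly set)"
proof -
  have "esym (card S) = monomial (indicator_exp S) +
      (\<Sum>A\<in>{A. card A = card S} - {S}. monomial (indicator_exp A) :: ('n, 'k) mpoly)"
    unfolding esym_def by (rule sum.remove) auto
  moreover have "(\<Sum>A\<in>{A. card A = card S} - {S}. monomial (indicator_exp A) :: ('n, 'k) mpoly) \<in> var_ideal (- S)"
  proof (intro ideal'_sum ideal'_var_ideal)
    fix A assume "A \<in> {A. card A = card S} - {S}"
    then have "\<not> A \<subseteq> S" using card_subset_eq[of S A] by auto
    then show "(monomial (indicator_exp A) :: ('n, 'k) mpoly) \<in> var_ideal (- S)"
      by (auto simp: prime_exps_def lookup_indicator_exp)
  qed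
  ultimately show ?thesis by simp
qed

abbreviation esyms :: "nat \<Rightarrow> ('n::finite, 'k::field) mpoly list" where
  "esyms t \<equiv> map esym [1..<Suc t]"

lemma nzd_indicator_exp:
  "(\<And>i. i \<in> A \<Longrightarrow> nzd J (var i)) \<Longrightarrow> nzd J (monomial (indicator_exp A) :: ('n::finite, 'k::field) mpoly)"
  unfolding indicator_exp_def
  by (induction A rule: infinite_finite_induct)
    (auto simp: monomial_0 monomial_add nzd_1 var_def intro!: nzd_mult)

text \<open>Modulo a variable \<open>x\<close> the number of variables drops, and \<open>x\<close> can be rotated behind the
  elementary symmetric polynomials; the last one of them is the product of all variables.\<close>

lemma wreg_esyms:
  fixes S :: "'n::{finite,linorder} set"
  assumes "t \<le> card S"
  shows "wreg (var_ideal (- S) :: ('n, 'k::field) mpoly set) (esyms t)"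
  using assms
proof (induction "card S" arbitrary: S t)
  case (Suc s)
  let ?J = "var_ideal (- S) :: ('n, 'k) mpoly set"
  \<comment> \<open>Modulo \<open>var i\<close> only \<open>s\<close> variables remain, so the
    induction hypothesis covers at most \<open>s\<close> of the polynomials.\<close>
  have rot: "wreg ?J (esyms u @ [var i])" if "i \<in> S" "u \<le> s" for i u
  proof (rule wreg_rotate)
    show "ideal' ?J" by (rule ideal'_var_ideal)
    have "s = card (S - {i})" using Suc.hyps(2) that by simp
    then have "wreg (var_ideal (- (S - {i})) :: ('n, 'k) mpoly set) (esyms u)"
      using Suc.hyps(1)[of "S - {i}" u] that by simp
    also have "- (S - {i}) = insert i (- S)" using that by auto
    finally show "wreg ?J (var i # esyms u)"
      using that by (simp add: adj_var_ideal nzd_var_ideal del: upt_Suc)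
    show "m \<in> adjs ?J (take k (esyms u))"
      if "\<And>l. m \<in> adj (adjs ?J (take k (esyms u))) (var i ^ l)" for k m
    proof (rule graded_separated)
      show "ideal' (adjs ?J (take k (esyms u)))" by (intro ideal'_adjs ideal'_var_ideal)
      show "graded (adjs ?J (take k (esyms u)))"
        by (intro graded_adjs graded_mideal) (use keys_esym in \<open>fastforce dest!: in_set_takeD simp del: upt_Suc\<close>)
      show "var i \<in> mideal (order_exps 1)" by (simp only: var_ideal_UNIV[symmetric] var_in_var_ideal UNIV_I)
    qed (rule that)
  qed
  show ?case
  proof (cases "t \<le> s")
    case True
    obtain i where "i \<in> S" using Suc.hyps(2) by fastforce
    from rot[OF this True] show ?thesis by (simp add: wreg_append del: upt_Suc)
  next
    case False
    then have t: "t = Suc s" using Suc by simp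
    obtain i where "i \<in> S" using Suc.hyps(2) by fastforce
    let ?K = "adjs ?J (esyms s)"
    \<comment> \<open>By \<open>rot\<close> every variable of \<open>S\<close> is a non-zero-divisor
      modulo the first \<open>s\<close> polynomials, hence so is the product of these variables, to
      which \<open>esym (Suc s)\<close> is congruent.\<close>
    have "nzd ?K (monomial (indicator_exp S))"
      using rot by (intro nzd_indicator_exp) (simp add: wreg_append del: upt_Suc)
    moreover have "esym (Suc s) - monomial (indicator_exp S) \<in> ?K"
      using esym_cong[of S] subset_adjs Suc.hyps(2) by fastforce
    ultimately have "nzd ?K (esym (Suc s))"
      using nzd_cong[OF ideal'_adjs[OF ideal'_var_ideal]] by blast
    moreover have "esyms t = (esyms s @ [esym (Suc s)] :: ('n, 'k) mpoly list)"
      by (simp add: t)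
    moreover have "wreg ?J (esyms s)"
      using rot[OF \<open>i \<in> S\<close> order_refl] by (simp add: wreg_append del: upt_Suc)
    ultimately show ?thesis by (simp only: wreg_append wreg.simps simp_thms)
  qed
qed simp

section \<open>Ideals of Veronese type\<close>

text \<open>The Veronese ideal in the variables of \<open>S\<close>, together with all variables
  outside \<open>S\<close>; the truncated sum reaches \<open>d\<close> exactly when a generator
  divides the monomial. Letting \<open>S\<close> vary closes the family under the two operations of
  the induction.\<close>

definition veronese_exps :: "'n set \<Rightarrow> nat \<Rightarrow> ('n \<Rightarrow> nat) \<Rightarrow> ('n \<Rightarrow>\<^sub>0 nat) set" where
  "veronese_exps S d a = prime_exps (- S) \<union> {e. d \<le> (\<Sum>j\<in>S. min (Poly_Mapping.lookup e j) (a j))}"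

lemma upset_veronese_exps: "upset (veronese_exps S d a)"
proof -
  have "d \<le> (\<Sum>j\<in>S. min (Poly_Mapping.lookup (e' + e) j) (a j))"
    if "d \<le> (\<Sum>j\<in>S. min (Poly_Mapping.lookup e j) (a j))" for e e'
    using that by (rule order_trans) (intro sum_mono, auto simp: lookup_add)
  then show ?thesis
    using upset_prime_exps[of "- S"] by (auto simp: veronese_exps_def upset_def)
qed

text \<open>Since \<open>min (e_i + 1) a_i = min e_i (a_i - 1) + 1\<close>, one factor
  \<open>x_i\<close> accounts for one unit of \<open>d\<close> and one unit of its own
  bound.\<close>

lemma veronese_exps_colon:
  assumes "i \<in> S" "finite S" "0 < a i"
  shows "{e. Poly_Mapping.single i 1 + e \<in> veronese_exps S (Suc d) a} = veronese_exps S d (a(i := a i - 1))"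
proof -
  have "(\<Sum>j\<in>S. min (Poly_Mapping.lookup (Poly_Mapping.single i 1 + e) j) (a j)) =
      Suc (\<Sum>j\<in>S. min (Poly_Mapping.lookup e j) ((a(i := a i - 1)) j))" (is "?L = Suc ?R") for e
  proof -
    have "?L = min (Suc (Poly_Mapping.lookup e i)) (a i) +
        (\<Sum>j\<in>S - {i}. min (Poly_Mapping.lookup (Poly_Mapping.single i 1 + e) j) (a j))"
      using assms by (simp add: sum.remove[of S i] lookup_add lookup_single)
    also have "(\<Sum>j\<in>S - {i}. min (Poly_Mapping.lookup (Poly_Mapping.single i 1 + e) j) (a j)) =
        (\<Sum>j\<in>S - {i}. min (Poly_Mapping.lookup e j) ((a(i := a i - 1)) j))"
      by (intro sum.cong) (auto simp: lookup_add lookup_single)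
    also have "min (Suc (Poly_Mapping.lookup e i)) (a i) =
        Suc (min (Poly_Mapping.lookup e i) ((a(i := a i - 1)) i))"
      using assms by simp
    finally show ?thesis using assms by (simp add: sum.remove[of S i])
  qed
  then show ?thesis
    using assms by (auto simp: veronese_exps_def prime_exps_def lookup_add lookup_single when_def)
qed

lemma veronese_exps_remove:
  assumes "i \<in> S" "finite S"
  shows "veronese_exps S d a \<union> {e. 0 < Poly_Mapping.lookup e i} = veronese_exps (S - {i}) d a"
  using assms
  by (auto simp: veronese_exps_def prime_exps_def sum.remove[of S i])

lemma veronese_exps_eq_prime_exps:
  assumes "(\<Sum>j\<in>S. a j) < d"
  shows "veronese_exps S d a = prime_exps (- S)"
proof -
  have "(\<Sum>j\<in>S. min (Poly_Mapping.lookup e j) (a j)) < d" for e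
    using assms by (rule le_less_trans[rotated]) (simp add: sum_mono)
  then show ?thesis by (auto simp: veronese_exps_def simp flip: not_less)
qed

text \<open>Induction along the exact sequences \<open>0 \<rightarrow> R/(I : x) \<rightarrow> R/I \<rightarrow> R/(I + (x)) \<rightarrow> 0\<close>, whose outer
  terms are again of Veronese type.\<close>

lemma wreg_veronese:
  fixes S :: "'n::{finite,linorder} set"
  assumes "t \<le> card S" "t + 1 + (\<Sum>j\<in>S. a j) \<le> d + card S"
  shows "wreg (mideal (veronese_exps S d a) :: ('n, 'k::field) mpoly set) (esyms t)"
  using assms
proof (induction "card S + (\<Sum>j\<in>S. a j)" arbitrary: S a d rule: less_induct)
  case less
  consider "d = 0" | "(\<Sum>j\<in>S. a j) < d" | d' where "d = Suc d'" "d \<le> (\<Sum>j\<in>S. a j)"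
    by (cases d) force+
  then show ?case
  proof cases
    case 1
    then have "mideal (veronese_exps S d a) = (UNIV :: ('n, 'k) mpoly set)"
      by (auto simp: mideal_def veronese_exps_def)
    then show ?thesis by (simp only: wreg_UNIV)
  next
    case 2
    then show ?thesis
      using less.prems by (simp only: veronese_exps_eq_prime_exps wreg_esyms)
  next
    case (3 d')
    then have "(\<Sum>j\<in>S. a j) \<noteq> 0" by linarith
    then obtain i where i: "i \<in> S" "0 < a i" by (metis gr0I sum.neutral)
    let ?a = "a(i := a i - 1)"
    have sa: "(\<Sum>j\<in>S. a j) = a i + (\<Sum>j\<in>S - {i}. a j)"
      using i by (simp add: sum.remove)
    have "(\<Sum>j\<in>S. ?a j) = ?a i + (\<Sum>j\<in>S - {i}. ?a j)"
      using i by (intro sum.remove) auto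
    also have "(\<Sum>j\<in>S - {i}. ?a j) = (\<Sum>j\<in>S - {i}. a j)" by (intro sum.cong) auto
    finally have sa': "Suc (\<Sum>j\<in>S. ?a j) = (\<Sum>j\<in>S. a j)" using i sa by simp
    have cS: "card S = Suc (card (S - {i}))"
      using i by (metis card.remove finite)
    show ?thesis
    proof (rule wreg_colon_adj[of _ "var i"])
      show "ideal' (mideal (veronese_exps S d a) :: ('n, 'k) mpoly set)"
        by (intro ideal'_mideal upset_veronese_exps)
      \<comment> \<open>Both \<open>d\<close> and the sum of the bounds drop by one, which preserves
        the inequality.\<close>
      have "wreg (mideal (veronese_exps S d' ?a) :: ('n, 'k) mpoly set) (esyms t)"
        by (rule less.hyps) (use less.prems sa' 3 in linarith)+
      then show "wreg (colon (mideal (veronese_exps S d a) :: ('n, 'k) mpoly set) (var i)) (esyms t)"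
        using i by (simp only: var_def colon_mideal 3(1) veronese_exps_colon finite)
      \<comment> \<open>One variable is lost, but the sum drops by \<open>a i >= 1\<close>. As
        \<open>d\<close> is at most the sum, the inequality also gives
        \<open>t + 1 <= card S\<close>, so \<open>t\<close> still fits.\<close>
      have "wreg (mideal (veronese_exps (S - {i}) d a) :: ('n, 'k) mpoly set) (esyms t)"
        by (rule less.hyps) (use less.prems sa 3 i cS in linarith)+
      then show "wreg (adj (mideal (veronese_exps S d a) :: ('n, 'k) mpoly set) (var i)) (esyms t)"
        using i by (simp only: var_def adj_mideal upset_veronese_exps range_plus_single
            veronese_exps_remove finite)
    qed
  qed
qed

section \<open>Generators of monomial ideals\<close>

lemma exp_with_sum:
  fixes b :: "'n::finite \<Rightarrow> nat"
  assumes "d \<le> (\<Sum>j\<in>UNIV. b j)"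
  obtains c :: "'n \<Rightarrow>\<^sub>0 nat" where "edeg c = d" "\<And>j. Poly_Mapping.lookup c j \<le> b j"
proof -
  have "\<exists>c :: 'n \<Rightarrow>\<^sub>0 nat. edeg c = d \<and> (\<forall>j. Poly_Mapping.lookup c j \<le> b j)"
    using assms
  proof (induction d)
    case 0
    then show ?case by (intro exI[of _ 0]) (simp add: edeg_def)
  next
    case (Suc d)
    then obtain c :: "'n \<Rightarrow>\<^sub>0 nat" where c: "edeg c = d" "\<forall>j. Poly_Mapping.lookup c j \<le> b j" by auto
    have "\<exists>i. Poly_Mapping.lookup c i < b i"
    proof (rule ccontr)
      assume "\<nexists>i. Poly_Mapping.lookup c i < b i"
      then have "(\<Sum>j\<in>UNIV. b j) \<le> edeg c" unfolding edeg_def by (intro sum_mono) (simp add: not_less)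
      with Suc.prems c show False by simp
    qed
    then obtain i where "Poly_Mapping.lookup c i < b i" ..
    with c show ?case
      by (intro exI[of _ "c + Poly_Mapping.single i 1"])
        (auto simp: edeg_add edeg_single lookup_add lookup_single when_def)
  qed
  then show ?thesis using that by blast
qed

lemma genideal_eq_mideal:
  fixes G :: "('n \<Rightarrow>\<^sub>0 nat) set"
  assumes "upset E" "G \<subseteq> E" "\<And>e. e \<in> E \<Longrightarrow> \<exists>c\<in>G. \<exists>e'. e = c + e'"
  shows "Idl\<^bsub>poly_ring\<^esub> (monomial ` G) = (mideal E :: ('n, 'k::field) mpoly set)"
proof
  interpret R: cring "poly_ring :: ('n, 'k) mpoly ring"
    by (rule cring_from_type_algebra)
  show "Idl\<^bsub>poly_ring\<^esub> (monomial ` G) \<subseteq> (mideal E :: ('n, 'k) mpoly set)"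
    using assms by (intro R.genideal_minimal ideal'_mideal) auto
  have I: "ideal' (Idl\<^bsub>poly_ring\<^esub> (monomial ` G) :: ('n, 'k) mpoly set)"
    by (rule R.genideal_ideal) simp
  show "mideal E \<subseteq> (Idl\<^bsub>poly_ring\<^esub> (monomial ` G) :: ('n, 'k) mpoly set)"
  proof (rule mideal_least[OF I])
    fix e assume "e \<in> E"
    then obtain c e' where c: "c \<in> G" "e = c + e'" using assms by blast
    have "monomial c \<in> (Idl\<^bsub>poly_ring\<^esub> (monomial ` G) :: ('n, 'k) mpoly set)"
      using c by (intro R.genideal_self[THEN subsetD]) auto
    then show "monomial e \<in> (Idl\<^bsub>poly_ring\<^esub> (monomial ` G) :: ('n, 'k) mpoly set)"
      using ideal'_mult_right[OF I] by (simp add: c monomial_add)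
  qed
qed

lemma irrelevant_ideal_eq: "irrelevant_ideal = (var_ideal UNIV :: ('n, 'k::field) mpoly set)"
proof -
  have "range (var :: 'n \<Rightarrow> ('n, 'k) mpoly) = monomial ` range (\<lambda>i. Poly_Mapping.single i 1)"
    by (auto simp: var_def)
  moreover have "\<exists>c\<in>range (\<lambda>i. Poly_Mapping.single i 1). \<exists>e'. e = c + e'" if "e \<in> prime_exps UNIV"
    for e :: "'n \<Rightarrow>\<^sub>0 nat"
    using that range_plus_single[where ?'n = 'n] by (fastforce simp: prime_exps_def)
  moreover have "Poly_Mapping.single i 1 \<in> prime_exps UNIV" for i :: 'n
    by (auto simp: prime_exps_def intro!: exI[of _ i])
  ultimately show ?thesis
    unfolding irrelevant_ideal_def by (simp only:) (intro genideal_eq_mideal upset_prime_exps, auto)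
qed

lemma veronese_ideal_eq:
  "veronese_ideal d a = (mideal (veronese_exps UNIV d a) :: ('n::finite, 'k::field) mpoly set)"
proof -
  let ?G = "{e. (\<Sum>j\<in>UNIV. Poly_Mapping.lookup e j) = d \<and> (\<forall>j. Poly_Mapping.lookup e j \<le> a j)}"
  have "veronese_ideal d a = Idl\<^bsub>poly_ring\<^esub> (monomial ` ?G :: ('n, 'k) mpoly set)"
    unfolding veronese_ideal_def by (rule arg_cong[of _ _ "genideal poly_ring"]) auto
  also have "\<dots> = mideal (veronese_exps UNIV d a)"
  proof (rule genideal_eq_mideal[OF upset_veronese_exps])
    show "?G \<subseteq> veronese_exps UNIV d a" by (auto simp: veronese_exps_def min_absorb1)
    fix e :: "'n \<Rightarrow>\<^sub>0 nat" assume "e \<in> veronese_exps UNIV d a"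
    then have "d \<le> (\<Sum>j\<in>UNIV. min (Poly_Mapping.lookup e j) (a j))"
      by (auto simp: veronese_exps_def prime_exps_def)
    \<comment> \<open>An exponent of degree exactly \<open>d\<close> below both \<open>e\<close> and
      \<open>a\<close> is that of a generator dividing the monomial of \<open>e\<close>.\<close>
    then obtain c where c: "edeg c = d" "\<And>j. Poly_Mapping.lookup c j \<le> min (Poly_Mapping.lookup e j) (a j)"
      by (rule exp_with_sum) blast
    then have "c \<in> ?G" by (auto simp: edeg_def)
    moreover have "e = c + (e - c)"
      using c(2) by (intro poly_mapping_eqI) (auto simp: lookup_add lookup_minus)
    ultimately show "\<exists>c\<in>?G. \<exists>e'. e = c + e'" by blast
  qed
  finally show ?thesis .
qed

section \<open>Quotients, depth and dimension in terms of representatives\<close>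

lemma prime_chainI:
  "(\<And>i. i \<le> r \<Longrightarrow> primeideal (C i) R) \<Longrightarrow> (\<And>i. i < r \<Longrightarrow> C i \<subset> C (Suc i)) \<Longrightarrow> prime_chain R C r"
  by (simp add: prime_chain_def)

lemma
  assumes "prime_chain R C r"
  shows prime_chain_primeideal: "i \<le> r \<Longrightarrow> primeideal (C i) R"
    and prime_chain_psubset: "i < r \<Longrightarrow> C i \<subset> C (Suc i)"
  using assms by (simp_all add: prime_chain_def)

context
  fixes I :: "'a::comm_ring_1 set"
  assumes I: "ideal' I"
begin

interpretation R: cring "ring_of_type_algebra :: 'a ring"
  by (rule cring_from_type_algebra)

interpretation I: ideal I "ring_of_type_algebra :: 'a ring"
  by (rule I)

interpretation Q: cring "ring_of_type_algebra Quot I"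
  by (rule I.quotient_is_cring[OF R.is_cring])

interpretation M: module "ring_of_type_algebra :: 'a ring" "quot_module ring_of_type_algebra I"
  by (rule R.quot_module_module[OF I])

abbreviation coset :: "'a \<Rightarrow> 'a set" where
  "coset p \<equiv> I +>\<^bsub>ring_of_type_algebra\<^esub> p"

lemma coset_eq: "coset p = {j + p |j. j \<in> I}"
  by (auto simp: a_r_coset_def')

lemma coset_eq_iff: "coset p = coset q \<longleftrightarrow> p - q \<in> I"
proof
  assume "coset p = coset q"
  moreover have "p \<in> coset p" unfolding coset_eq using ideal'_0[OF I] by force
  ultimately obtain j where "j \<in> I" "p = j + q" unfolding coset_eq by auto
  then show "p - q \<in> I" by simp
next
  assume *: "p - q \<in> I"
  have "j + p = (j + (p - q)) + q" "j + q = (j - (p - q)) + p" for j by simp_all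
  with * show "coset p = coset q"
    unfolding coset_eq using I by (blast intro: ideal'_add ideal'_diff)
qed

lemma carrier_Quot: "carrier (ring_of_type_algebra Quot I) = range coset"
  by (auto simp: FactRing_def A_RCOSETS_def')

lemma Quot_mult: "coset p \<otimes>\<^bsub>ring_of_type_algebra Quot I\<^esub> coset q = coset (p * q)"
  by (simp add: FactRing_def I.rcoset_mult_add)

lemma coset_in_image_iff:
  assumes "ideal' D" "I \<subseteq> D" shows "coset p \<in> coset ` D \<longleftrightarrow> p \<in> D"
proof
  assume "coset p \<in> coset ` D"
  then obtain q where q: "q \<in> D" "p - q \<in> I" by (auto simp: coset_eq_iff)
  then have "(p - q) + q \<in> D" using assms by (blast intro: ideal'_add)
  then show "p \<in> D" by simp
qed simp

lemma primeideal_coset_image: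
  assumes "primeideal D ring_of_type_algebra" "I \<subseteq> D"
  shows "primeideal (coset ` D) (ring_of_type_algebra Quot I)"
proof (rule primeidealI)
  note D = primeideal_imp_ideal'[OF assms(1)]
  show "ideal (coset ` D) (ring_of_type_algebra Quot I)"
    by (rule R.ring_ideal_imp_quot_ideal[OF I D])
  show "cring (ring_of_type_algebra Quot I)" by (rule Q.is_cring)
  have "coset 1 \<notin> coset ` D"
    using primeideal_1[OF assms(1)] by (simp add: coset_in_image_iff[OF D assms(2)])
  then show "carrier (ring_of_type_algebra Quot I) \<noteq> coset ` D"
    unfolding carrier_Quot by blast
  fix x y assume "x \<in> carrier (ring_of_type_algebra Quot I)" "y \<in> carrier (ring_of_type_algebra Quot I)"
    and xy: "x \<otimes>\<^bsub>ring_of_type_algebra Quot I\<^esub> y \<in> coset ` D"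
  then obtain p q where "x = coset p" "y = coset q" by (auto simp: carrier_Quot)
  with xy assms(1) show "x \<in> coset ` D \<or> y \<in> coset ` D"
    by (auto simp: Quot_mult coset_in_image_iff[OF D assms(2)] primeideal_iff)
qed

lemma primeideal_coset_vimage:
  assumes "primeideal D (ring_of_type_algebra Quot I)"
  shows "primeideal {p. coset p \<in> D} ring_of_type_algebra" "I \<subseteq> {p. coset p \<in> D}"
proof -
  show "primeideal {p. coset p \<in> D} ring_of_type_algebra"
    using ring_hom_ring.primeideal_vimage[OF I.rcos_ring_hom_ring R.is_cring assms] by simp
  have "I \<in> D"
    using additive_subgroup.zero_closed[OF ideal.axioms(1)[OF primeideal.axioms(1)[OF assms]]]
    by (simp add: FactRing_def)
  moreover have "coset p = I" if "p \<in> I" for p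
    using coset_eq_iff[of p 0] that R.a_coset_add_zero[of I] by simp
  ultimately show "I \<subseteq> {p. coset p \<in> D}" by auto
qed

lemma prime_chain_Quot_iff:
  "(\<exists>C. prime_chain (ring_of_type_algebra Quot I) C r) \<longleftrightarrow>
    (\<exists>C. prime_chain ring_of_type_algebra C r \<and> I \<subseteq> C 0)"
proof
  assume "\<exists>C. prime_chain (ring_of_type_algebra Quot I) C r"
  then obtain C where C: "prime_chain (ring_of_type_algebra Quot I) C r" ..
  have "{p. coset p \<in> C i} \<subset> {p. coset p \<in> C (Suc i)}" if "i < r" for i
  proof -
    from C that have "C i \<subset> C (Suc i)" "primeideal (C (Suc i)) (ring_of_type_algebra Quot I)"
      by (auto simp: prime_chain_def)
    moreover from this have "C (Suc i) \<subseteq> range coset"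
      using additive_subgroup.a_subset[OF ideal.axioms(1)[OF primeideal.axioms(1)]] carrier_Quot by blast
    ultimately show ?thesis by blast
  qed
  moreover have "primeideal {p. coset p \<in> C i} ring_of_type_algebra" "I \<subseteq> {p. coset p \<in> C i}"
    if "i \<le> r" for i
    using C that primeideal_coset_vimage by (auto simp only: prime_chain_def)
  ultimately show "\<exists>C. prime_chain ring_of_type_algebra C r \<and> I \<subseteq> C 0"
    by (intro exI[of _ "\<lambda>i. {p. coset p \<in> C i}"] conjI prime_chainI) simp_all
next
  assume "\<exists>C. prime_chain ring_of_type_algebra C r \<and> I \<subseteq> C 0"
  then obtain C where C: "prime_chain ring_of_type_algebra C r" "I \<subseteq> C 0" by blast
  have sub: "I \<subseteq> C i" if "i \<le> r" for i
    using that
  proof (induction i)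
    case (Suc i)
    with prime_chain_psubset[OF C(1), of i] show ?case by simp
  qed (rule C(2))
  have "primeideal (coset ` C i) (ring_of_type_algebra Quot I)" if "i \<le> r" for i
    using C that sub by (intro primeideal_coset_image) (auto simp only: prime_chain_def)
  moreover have "coset ` C i \<subset> coset ` C (Suc i)" if "i < r" for i
  proof -
    from C that have *: "C i \<subset> C (Suc i)" "ideal' (C i)"
      by (auto simp: prime_chain_def intro: primeideal_imp_ideal')
    then obtain p where "p \<in> C (Suc i)" "p \<notin> C i" by blast
    then have "coset p \<notin> coset ` C i"
      using coset_in_image_iff[OF *(2) sub] that by simp
    with * \<open>p \<in> C (Suc i)\<close> show ?thesis by blast
  qed
  ultimately show "\<exists>C. prime_chain (ring_of_type_algebra Quot I) C r"
    by (intro exI[of _ "\<lambda>i. coset ` C i"] prime_chainI)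
qed

section \<open>Regular sequences and associated primes of the quotient module\<close>

lemma carrier_quot_module: "carrier (quot_module ring_of_type_algebra I) = range coset"
  by (simp add: quot_module_def carrier_Quot)

lemma smult_quot_module: "r \<odot>\<^bsub>quot_module ring_of_type_algebra I\<^esub> coset p = coset (r * p)"
  by (simp add: quot_module_def Quot_mult)

lemma add_quot_module: "coset p \<oplus>\<^bsub>quot_module ring_of_type_algebra I\<^esub> coset q = coset (p + q)"
  using ring_hom_add[OF I.rcos_ring_hom, of p q] by (simp add: quot_module_def)

lemma zero_quot_module: "\<zero>\<^bsub>quot_module ring_of_type_algebra I\<^esub> = coset 0"
  using R.a_coset_add_zero[of I] by (simp add: quot_module_def FactRing_def)

lemma submodule_mult_quot_module:
  "submodule_mult ring_of_type_algebra (quot_module ring_of_type_algebra I) (set fs) = coset ` adjs I fs"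
  (is "?L = ?R")
proof
  let ?M = "quot_module ring_of_type_algebra I"
  let ?G = "{f \<odot>\<^bsub>?M\<^esub> x | f x. f \<in> set fs \<and> x \<in> carrier ?M}"
  note K = ideal'_adjs[OF I, of fs]
  have "submodule ?R ring_of_type_algebra ?M"
  proof (rule M.submoduleI)
    show "?R \<subseteq> carrier ?M" by (auto simp: carrier_quot_module)
    show "\<zero>\<^bsub>?M\<^esub> \<in> ?R" using ideal'_0[OF K] by (simp add: zero_quot_module)
    show "x \<oplus>\<^bsub>?M\<^esub> y \<in> ?R" if "x \<in> ?R" "y \<in> ?R" for x y
      using that ideal'_add[OF K] by (auto simp: add_quot_module)
    show smult: "r \<odot>\<^bsub>?M\<^esub> x \<in> ?R" if "x \<in> ?R" for r x
      using that ideal'_mult_left[OF K] by (auto simp: smult_quot_module)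
    show "\<ominus>\<^bsub>?M\<^esub> x \<in> ?R" if "x \<in> ?R" for x
    proof -
      from that obtain p where p: "x = coset p" "p \<in> adjs I fs" by blast
      have "\<ominus>\<^bsub>?M\<^esub> x = coset (- p)"
        by (rule M.minus_equality)
          (simp_all add: p add_quot_module zero_quot_module carrier_quot_module)
      then show ?thesis using ideal'_uminus[OF K p(2)] by simp
    qed
  qed
  moreover have "?G \<subseteq> ?R"
    using set_subset_adjs[OF I, of fs] ideal'_mult_right[OF K]
    by (auto simp: carrier_quot_module smult_quot_module)
  ultimately show "?L \<subseteq> ?R"
    unfolding submodule_mult_def by blast
  show "?R \<subseteq> ?L"
    unfolding submodule_mult_def
  proof (intro Inter_greatest)
    fix N assume "N \<in> {N. submodule N ring_of_type_algebra ?M \<and> ?G \<subseteq> N}"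
    then have N: "submodule N ring_of_type_algebra ?M" "?G \<subseteq> N" by auto
    note NE = M.submoduleE[OF N(1)]
    have zero: "coset 0 \<in> N"
      using subgroup.one_closed[OF submodule.axioms(1)[OF N(1)]] by (simp add: zero_quot_module)
    let ?N = "{p. coset p \<in> N}"
    have "ideal' ?N"
    proof (rule ideal'I)
      show "0 \<in> ?N" using zero by simp
      show "x + y \<in> ?N" if "x \<in> ?N" "y \<in> ?N" for x y
        using NE(5)[of "coset x" "coset y"] that by (simp add: add_quot_module)
      show "r * x \<in> ?N" if "x \<in> ?N" for x r
        using NE(4)[of r "coset x"] that by (simp add: smult_quot_module)
    qed
    moreover have "I \<subseteq> ?N"
    proof
      fix p assume "p \<in> I"
      then have "coset p = coset 0" by (simp add: coset_eq_iff)
      with zero show "p \<in> ?N" by simp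
    qed
    moreover have "set fs \<subseteq> ?N"
    proof
      fix f assume "f \<in> set fs"
      then have "f \<odot>\<^bsub>?M\<^esub> coset 1 \<in> ?G" by (auto simp: carrier_quot_module)
      with N(2) show "f \<in> ?N" by (auto simp: smult_quot_module)
    qed
    ultimately have "adjs I fs \<subseteq> ?N" by (rule adjs_least)
    then show "?R \<subseteq> N" by auto
  qed
qed

lemma wreg_iff_nth:
  "wreg J fs \<longleftrightarrow> (\<forall>i<length fs. nzd (adjs J (take i fs)) (fs ! i))"
proof (induction fs arbitrary: J)
  case (Cons f fs)
  then show ?case by (simp add: All_less_Suc2)
qed simp

lemma regular_sequence_quot_module_iff:
  "regular_sequence ring_of_type_algebra (quot_module ring_of_type_algebra I) fs \<longleftrightarrow>
    wreg I fs \<and> 1 \<notin> adjs I fs"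
proof -
  have mem: "coset p \<in> coset ` adjs I gs \<longleftrightarrow> p \<in> adjs I gs" for p gs
    by (rule coset_in_image_iff[OF ideal'_adjs[OF I] subset_adjs])
  have "coset ` adjs I fs \<noteq> range coset \<longleftrightarrow> 1 \<notin> adjs I fs"
  proof
    assume *: "coset ` adjs I fs \<noteq> range coset"
    show "1 \<notin> adjs I fs"
    proof
      assume "1 \<in> adjs I fs"
      then have "p \<in> adjs I fs" for p
        using ideal'_mult_left[OF ideal'_adjs[OF I], of 1 fs p] by simp
      with * show False by auto
    qed
  qed (use mem[of 1 fs] in auto)
  then show ?thesis
    by (simp add: regular_sequence_def submodule_mult_quot_module carrier_quot_module
        smult_quot_module mem wreg_iff_nth nzd_def)
qed

lemma associated_primes_quot_module:
  "associated_primes ring_of_type_algebra (quot_module ring_of_type_algebra I) =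
    {P. primeideal P ring_of_type_algebra \<and> (\<exists>u. P = colon I u)}"
proof -
  have "r \<odot>\<^bsub>quot_module ring_of_type_algebra I\<^esub> coset u = \<zero>\<^bsub>quot_module ring_of_type_algebra I\<^esub> \<longleftrightarrow>
      u * r \<in> I" for r u
    by (simp add: smult_quot_module zero_quot_module coset_eq_iff mult.commute)
  then show ?thesis
    by (simp add: associated_primes_def carrier_quot_module colon_def)
qed

end

text \<open>If no value reached \<open>N\<close>, all would be at most \<open>N - 1\<close>. This
  fails for \<open>N = 0\<close>, since the supremum of the empty set is 0.\<close>

lemma enat_le_SUP_imp:
  assumes "enat N \<le> (SUP x\<in>A. enat (f x))" "N \<noteq> 0"
  shows "\<exists>x\<in>A. N \<le> f x"
proof (rule ccontr)
  assume "\<not> ?thesis"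
  then have "(SUP x\<in>A. enat (f x)) \<le> enat (N - 1)"
    by (intro SUP_least) (auto simp: not_le)
  with assms(1) have "enat N \<le> enat (N - 1)" by (rule order_trans)
  with assms(2) show False by simp
qed

section \<open>Heights and dimensions of monomial ideals\<close>

lemma var_ideal_chain:
  fixes F G :: "'n::{finite,linorder} set"
  assumes "F \<subseteq> G"
  shows "\<exists>C :: nat \<Rightarrow> ('n, 'k::field) mpoly set.
    prime_chain poly_ring C (card (G - F)) \<and> C 0 = var_ideal F \<and> C (card (G - F)) = var_ideal G"
proof -
  obtain xs where xs: "set xs = G - F" "distinct xs"
    using finite_distinct_list[of "G - F"] by auto
  then have len: "length xs = card (G - F)" by (metis distinct_card)
  let ?C = "\<lambda>i. var_ideal (F \<union> set (take i xs)) :: ('n, 'k) mpoly set"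
  have less: "?C i \<subset> ?C (Suc i)" if "i < length xs" for i
  proof -
    have "set (take (Suc i) xs) = insert (xs ! i) (set (take i xs))"
      using that by (simp add: take_Suc_conv_app_nth)
    moreover have "xs ! i \<notin> F \<union> set (take i xs)"
      using xs that nth_mem[OF that]
      by (auto simp: in_set_conv_nth nth_eq_iff_index_eq)
    ultimately have "var (xs ! i) \<in> ?C (Suc i)" "var (xs ! i) \<notin> ?C i" "?C i \<subseteq> ?C (Suc i)"
      by (auto intro!: mideal_mono prime_exps_mono)
    then show ?thesis by blast
  qed
  have "prime_chain poly_ring ?C (length xs)"
    by (intro prime_chainI primeideal_var_ideal less)
  moreover have "?C 0 = var_ideal F" "?C (length xs) = var_ideal G"
    using assms xs(1) by (simp_all add: Un_absorb1)
  ultimately show ?thesis unfolding len by blast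
qed

lemma prime_height_ge_card:
  fixes P :: "('n::{finite,linorder}, 'k::field) mpoly set"
  assumes "primeideal P poly_ring" "var_ideal F \<subseteq> P"
  shows "enat (card F) \<le> prime_height poly_ring P"
proof -
  obtain C :: "nat \<Rightarrow> ('n, 'k) mpoly set"
    where C: "prime_chain poly_ring C (card F)" "C (card F) = var_ideal F"
    using var_ideal_chain[of "{}" F] by auto
  \<comment> \<open>Only the top is replaced, so the length is kept even when \<open>P\<close>
    equals \<open>var_ideal F\<close>.\<close>
  have "prime_chain poly_ring (C(card F := P)) (card F)"
  proof (rule prime_chainI)
    show "primeideal ((C(card F := P)) i) poly_ring" if "i \<le> card F" for i
      using prime_chain_primeideal[OF C(1) that] assms(1) by simp
    show "(C(card F := P)) i \<subset> (C(card F := P)) (Suc i)" if "i < card F" for i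
      using prime_chain_psubset[OF C(1) that] assms(2) C(2) that by (cases "Suc i = card F") auto
  qed
  then have "\<exists>C'. prime_chain poly_ring C' (card F) \<and> C' (card F) = P"
    by (intro exI[of _ "C(card F := P)"]) simp
  then show ?thesis unfolding prime_height_def by (intro SUP_upper) simp
qed

text \<open>A chain ending in this prime, extended by adjoining the remaining variables up to the
  irrelevant ideal, is a climb to a proper ideal and has length at most \<open>n\<close>.\<close>

lemma prime_height_var_ideal_le:
  "prime_height poly_ring (var_ideal F :: ('n::{finite,linorder}, 'k::field) mpoly set) \<le> enat (card F)"
  unfolding prime_height_def
proof (intro SUP_least, clarsimp)
  fix r and C :: "nat \<Rightarrow> ('n, 'k) mpoly set"
  assume C: "prime_chain poly_ring C r" "C r = var_ideal F"
  have "climb (0 + r) (C r)"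
    using C(1) by (intro climb_prime_chain climb_0 primeideal_imp_ideal' prime_chain_primeideal[OF C(1)]) auto
  obtain D :: "nat \<Rightarrow> ('n, 'k) mpoly set" where
    D: "prime_chain poly_ring D (card (- F))" "D 0 = var_ideal F" "D (card (- F)) = var_ideal UNIV"
    using var_ideal_chain[of F UNIV] by (auto simp: Compl_eq_Diff_UNIV)
  have "climb (r + card (- F)) (D (card (- F)))"
    using \<open>climb (0 + r) (C r)\<close> C D by (intro climb_prime_chain) auto
  then have "r + card (- F) \<le> CARD('n)"
    by (intro climb_le_card) (auto simp: D prime_exps_def)
  moreover have "card (- F) = CARD('n) - card F" "card F \<le> CARD('n)"
    by (simp_all add: Compl_eq_Diff_UNIV card_Diff_subset card_mono)
  ultimately show "r \<le> card F" by linarith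
qed

lemma prime_contains_var:
  fixes P :: "('n::finite, 'k::field) mpoly set"
  assumes "primeideal P poly_ring" "monomial e \<in> P"
  shows "\<exists>i. 0 < Poly_Mapping.lookup e i \<and> var i \<in> P"
  using assms(2)
proof (induction "edeg e" arbitrary: e)
  case 0
  then have "e = 0" by (simp add: edeg_eq_0_iff)
  with 0 primeideal_1[OF assms(1)] show ?case by (simp add: monomial_0)
next
  case (Suc k)
  then have "\<exists>i. Poly_Mapping.lookup e i \<noteq> 0" unfolding edeg_def by (metis sum.neutral nat.distinct(1))
  then obtain i e' where e: "e = Poly_Mapping.single i 1 + e'"
    by (blast elim: lookup_posE)
  with Suc assms(1) have "var i \<in> P \<or> monomial e' \<in> P"
    by (auto simp: monomial_add var_def primeideal_iff)
  moreover have "edeg e' = k" using Suc.hyps(2) by (simp add: e edeg_add edeg_single)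
  ultimately show ?case using Suc.hyps(1)[of e'] by (auto simp: e lookup_add intro: exI[of _ i])
qed

lemma prime_contains_var_ideal:
  fixes P :: "('n::finite, 'k::field) mpoly set"
  assumes "primeideal P poly_ring" "mideal E \<subseteq> P"
  obtains F where "E \<subseteq> prime_exps F" "var_ideal F \<subseteq> P"
proof
  let ?F = "{i. var i \<in> P}"
  note P = primeideal_imp_ideal'[OF assms(1)]
  show "E \<subseteq> prime_exps ?F"
  proof
    fix e assume "e \<in> E"
    then have "monomial e \<in> (mideal E :: ('n, 'k) mpoly set)" by simp
    then have "monomial e \<in> P" using assms(2) by blast
    from prime_contains_var[OF assms(1) this] show "e \<in> prime_exps ?F"
      unfolding prime_exps_def by blast
  qed
  show "var_ideal ?F \<subseteq> P"
  proof (rule mideal_least[OF P])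
    fix e assume "e \<in> prime_exps ?F"
    then obtain i where i: "var i \<in> P" "0 < Poly_Mapping.lookup e i" by (auto simp: prime_exps_def)
    then obtain e' where "e = Poly_Mapping.single i 1 + e'" by (blast elim: lookup_posE)
    with i ideal'_mult_right[OF P] show "monomial e \<in> P" by (simp add: monomial_add var_def)
  qed
qed

text \<open>A minimal cover number: the fewest variables meeting the support of every exponent in
  \<open>E\<close>. For \<open>0 \<in> E\<close> there is no cover and \<open>LEAST\<close> is
  unspecified, so the results on its value assume \<open>0 \<notin> E\<close>.\<close>

definition mheight :: "('n::finite \<Rightarrow>\<^sub>0 nat) set \<Rightarrow> nat" where
  "mheight E = (LEAST h. \<exists>F. card F = h \<and> E \<subseteq> prime_exps F)"

lemma mheight_le: "E \<subseteq> prime_exps F \<Longrightarrow> mheight E \<le> card F"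
  unfolding mheight_def by (intro Least_le) blast

lemma mheight_attained:
  fixes E :: "('n::finite \<Rightarrow>\<^sub>0 nat) set"
  assumes "0 \<notin> E"
  obtains F where "card F = mheight E" "E \<subseteq> prime_exps F"
proof -
  have "e \<in> prime_exps UNIV" if "e \<in> E" for e
  proof (rule ccontr)
    assume "e \<notin> prime_exps UNIV"
    then have "e = 0" by (intro poly_mapping_eqI) (simp add: prime_exps_def)
    with that assms show False by simp
  qed
  then have "\<exists>F. card F = CARD('n) \<and> E \<subseteq> prime_exps F" by blast
  then have "\<exists>F. card F = mheight E \<and> E \<subseteq> prime_exps F"
    unfolding mheight_def by (rule LeastI)
  then show ?thesis using that by blast
qed

text \<open>A prime over a monomial ideal need not be monomial, but the variables in it generate a
  prime inside it that still contains the ideal, so only covers matter.\<close>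

lemma height_mideal:
  fixes E :: "('n::{finite,linorder} \<Rightarrow>\<^sub>0 nat) set"
  assumes "0 \<notin> E"
  shows "height poly_ring (mideal E :: ('n, 'k::field) mpoly set) = enat (mheight E)"
proof (rule antisym)
  obtain F where F: "card F = mheight E" "E \<subseteq> prime_exps F" using assms by (rule mheight_attained)
  have "height poly_ring (mideal E :: ('n, 'k) mpoly set) \<le> prime_height poly_ring (var_ideal F :: ('n, 'k) mpoly set)"
    unfolding height_def using F by (intro INF_lower) (simp add: primeideal_var_ideal mideal_mono)
  then show "height poly_ring (mideal E :: ('n, 'k) mpoly set) \<le> enat (mheight E)"
    using prime_height_var_ideal_le[of F] F(1) by (metis order_trans)
  show "enat (mheight E) \<le> height poly_ring (mideal E :: ('n, 'k) mpoly set)"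
    unfolding height_def
  proof (intro INF_greatest, clarify)
    fix P :: "('n, 'k) mpoly set" assume P: "primeideal P poly_ring" "mideal E \<subseteq> P"
    then obtain F where "E \<subseteq> prime_exps F" "var_ideal F \<subseteq> P" by (rule prime_contains_var_ideal)
    with P(1) show "enat (mheight E) \<le> prime_height poly_ring P"
      using prime_height_ge_card[of P F] mheight_le[of E F] by (meson enat_ord_simps(1) order_trans)
  qed
qed

text \<open>For the upper bound, the variables contained in the bottom prime form a climb into it,
  which the chain prolongs. For the lower bound, the variables outside a minimal cover are adjoined
  one by one.\<close>

lemma Krull_dim_mideal:
  fixes E :: "('n::{finite,linorder} \<Rightarrow>\<^sub>0 nat) set"
  assumes "upset E" "0 \<notin> E"
  shows "Krull_dim (poly_ring Quot (mideal E :: ('n, 'k::field) mpoly set)) = enat (CARD('n) - mheight E)"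
  unfolding Krull_dim_def prime_chain_Quot_iff[OF ideal'_mideal[OF assms(1)]]
proof (rule antisym)
  show "(SUP r\<in>{r. \<exists>C. prime_chain poly_ring C r \<and> (mideal E :: ('n, 'k) mpoly set) \<subseteq> C 0}. enat r)
      \<le> enat (CARD('n) - mheight E)"
  proof (intro SUP_least, clarsimp)
    fix r and C :: "nat \<Rightarrow> ('n, 'k) mpoly set"
    assume C: "prime_chain poly_ring C r" "mideal E \<subseteq> C 0"
    then have C0: "primeideal (C 0) poly_ring" and Cr: "primeideal (C r) poly_ring"
      by (auto simp: prime_chain_def)
    obtain F where F: "E \<subseteq> prime_exps F" "var_ideal F \<subseteq> C 0"
      using C0 C(2) by (rule prime_contains_var_ideal)
    have "climb (card F) (C 0)"
      using climb_mono[OF climb_var_ideal F(2) primeideal_imp_ideal'[OF C0]] by simp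
    then have "climb (card F + r) (C r)" using C(1) by (intro climb_prime_chain)
    then have "card F + r \<le> CARD('n)" by (rule climb_le_card) (rule primeideal_1[OF Cr])
    then show "r \<le> CARD('n) - mheight E" using mheight_le[OF F(1)] by simp
  qed
  obtain F where F: "card F = mheight E" "E \<subseteq> prime_exps F" using assms(2) by (rule mheight_attained)
  obtain C :: "nat \<Rightarrow> ('n, 'k) mpoly set" where
    "prime_chain poly_ring C (card (UNIV - F))" "C 0 = var_ideal F"
    using var_ideal_chain[of F UNIV] by auto
  moreover have "card (UNIV - F) = CARD('n) - mheight E"
    by (simp add: card_Diff_subset F(1))
  ultimately show "enat (CARD('n) - mheight E) \<le>
      (SUP r\<in>{r. \<exists>C. prime_chain poly_ring C r \<and> (mideal E :: ('n, 'k) mpoly set) \<subseteq> C 0}. enat r)"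
    using mideal_mono[OF F(2)] by (intro SUP_upper) auto
qed

text \<open>The chain up to the associated prime and the powers of the regular sequence, shifted by the
  annihilated element \<open>u\<close>, together form a climb; high powers keep \<open>u\<close> outside the top ideal.\<close>

lemma prime_chain_plus_regular_sequence_le:
  fixes fs :: "('n::{finite,linorder}, 'k::field) mpoly list" and u :: "('n, 'k) mpoly"
  assumes E: "upset E" and C: "prime_chain poly_ring C c" "C c = colon (mideal E) u"
    and fs: "wreg (mideal E) fs" "set fs \<subseteq> mideal (order_exps 1)"
  shows "c + length fs \<le> CARD('n)"
proof -
  let ?I = "mideal E :: ('n, 'k) mpoly set"
  note I = ideal'_mideal[OF E]
  have P: "primeideal (C c) poly_ring" using C(1) by (rule prime_chain_primeideal) simp
  have u: "u \<notin> ?I" using primeideal_1[OF P] by (simp add: C(2) colon_def)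
  obtain L where L: "\<forall>e\<in>Poly_Mapping.keys u. edeg e < L" by (rule edeg_bounded)
  \<comment> \<open>Every term of \<open>f^(L+1)\<close> has degree above that of \<open>u\<close>;
    \<open>Suc\<close> keeps the exponent positive, as \<open>wreg_map_power\<close> needs.\<close>
  let ?gs = "map (\<lambda>f. f ^ Suc L) fs"
  let ?K = "mideal (E \<union> order_exps (Suc L)) :: ('n, 'k) mpoly set"
  have "upset (E \<union> order_exps (Suc L))"
    using E upset_order_exps[of "Suc L"] by (auto simp: upset_def)
  then have "adjs ?I ?gs \<subseteq> ?K"
    using fs(2) mideal_mono[of "order_exps (Suc L)" "E \<union> order_exps (Suc L)"]
    by (intro adjs_least ideal'_mideal mideal_mono)
      (auto simp del: power_Suc dest!: subsetD intro!: power_in_order_ideal)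
  \<comment> \<open>Some term of \<open>u\<close> has its exponent outside \<open>E\<close>, and its
    degree is below \<open>L\<close>.\<close>
  moreover have "u \<notin> ?K"
    using u L by (fastforce simp: mideal_def order_exps_def)
  ultimately have 1: "1 \<notin> colon (adjs ?I ?gs) u" by (auto simp: colon_def)
  have "climb (0 + c) (C c)"
    using C(1) by (intro climb_prime_chain climb_0 primeideal_imp_ideal' prime_chain_primeideal[OF C(1)]) auto
  then have "climb (c + length ?gs) (colon (adjs ?I ?gs) u)"
    using fs(1) by (intro climb_wreg I wreg_map_power) (simp_all add: C(2))
  from climb_le_card[OF this 1] show ?thesis by simp
qed

section \<open>Almost Cohen-Macaulay ideals of Veronese type\<close>

lemma zero_notin_veronese_exps: "0 < d \<Longrightarrow> 0 \<notin> veronese_exps S d a"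
  by (simp add: veronese_exps_def prime_exps_def)

text \<open>The witness \<open>c\<close> equals \<open>a\<close> outside \<open>F\<close>, stays
  strictly below \<open>a\<close> on \<open>F\<close> and has degree \<open>d - 1\<close>. A
  variable of \<open>F\<close> raises the truncated sum to \<open>d\<close>, while the variables
  outside \<open>F\<close> are already saturated.\<close>

lemma colon_veronese:
  fixes F :: "'n::finite set" and a :: "'n \<Rightarrow> nat"
  assumes "\<And>j. 1 \<le> a j" "F \<noteq> {}" "(\<Sum>j\<in>- F. a j) < d" "d + card F \<le> 1 + (\<Sum>j\<in>UNIV. a j)"
  shows "\<exists>c. colon (mideal (veronese_exps UNIV d a)) (monomial c) = (var_ideal F :: ('n, 'k::field) mpoly set)"
proof -
  have "(\<Sum>j\<in>F. a j) = (\<Sum>j\<in>F. (a j - 1) + 1)" using assms(1) by (intro sum.cong) (simp_all add: Suc_le_eq)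
  then have "(\<Sum>j\<in>F. a j - 1) + card F = (\<Sum>j\<in>F. a j)"
    by (simp only: sum.distrib sum_constant mult_1_right of_nat_id)
  moreover have "(\<Sum>j\<in>UNIV. a j) = (\<Sum>j\<in>F. a j) + (\<Sum>j\<in>- F. a j)"
    by (subst sum.union_disjoint[symmetric]) (auto intro!: sum.cong)
  moreover have "(\<Sum>j\<in>UNIV. if j \<in> F then a j - 1 else 0) = (\<Sum>j\<in>F. a j - 1)"
    by (simp add: sum.If_cases)
  \<comment> \<open>The degree left for \<open>F\<close>: the third hypothesis keeps the subtraction
    from being truncated, the fourth provides the room.\<close>
  ultimately have "d - 1 - (\<Sum>j\<in>- F. a j) \<le> (\<Sum>j\<in>UNIV. if j \<in> F then a j - 1 else 0)"
    using assms(3,4) by linarith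
  then obtain c0 where c0: "edeg c0 = d - 1 - (\<Sum>j\<in>- F. a j)"
    "\<And>j. Poly_Mapping.lookup c0 j \<le> (if j \<in> F then a j - 1 else 0)"
    by (rule exp_with_sum) blast
  define c where "c = c0 + (\<Sum>j\<in>- F. Poly_Mapping.single j (a j))"
  have c1: "Poly_Mapping.lookup c j = (if j \<in> F then Poly_Mapping.lookup c0 j else a j)" for j
    using c0(2)[of j] by (auto simp: c_def lookup_add lookup_sum lookup_single when_def)
  have "edeg c = edeg c0 + (\<Sum>j\<in>UNIV. if j \<in> - F then a j else 0)"
    unfolding edeg_def c_def lookup_add
    by (simp add: sum.distrib lookup_sum lookup_single when_def)
  also have "(\<Sum>j\<in>UNIV. if j \<in> - F then a j else 0) = (\<Sum>j\<in>- F. a j)"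
    by (subst sum.If_cases) (simp_all add: Compl_eq)
  finally have c: "edeg c = d - 1" using c0(1) assms(3) by linarith
  have "d \<le> (\<Sum>j\<in>UNIV. min (Poly_Mapping.lookup (c + e) j) (a j)) \<longleftrightarrow> e \<in> prime_exps F" for e
  proof
    assume "e \<in> prime_exps F"
    then obtain i where i: "i \<in> F" "0 < Poly_Mapping.lookup e i" by (auto simp: prime_exps_def)
    have le: "Poly_Mapping.lookup c j \<le> min (Poly_Mapping.lookup (c + e) j) (a j)" for j
      using c0(2)[of j] assms(1)[of j] by (auto simp: c1 lookup_add)
    have "Poly_Mapping.lookup c i < min (Poly_Mapping.lookup (c + e) i) (a i)"
      using c0(2)[of i] assms(1)[of i] i by (auto simp: c1 lookup_add)
    then have "edeg c < (\<Sum>j\<in>UNIV. min (Poly_Mapping.lookup (c + e) j) (a j))"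
      unfolding edeg_def using le by (intro sum_strict_mono_ex1) auto
    then show "d \<le> (\<Sum>j\<in>UNIV. min (Poly_Mapping.lookup (c + e) j) (a j))" using c by linarith
  next
    assume d: "d \<le> (\<Sum>j\<in>UNIV. min (Poly_Mapping.lookup (c + e) j) (a j))"
    show "e \<in> prime_exps F"
    proof (rule ccontr)
      assume "e \<notin> prime_exps F"
      then have "(\<Sum>j\<in>UNIV. min (Poly_Mapping.lookup (c + e) j) (a j)) \<le> edeg c"
        unfolding edeg_def by (intro sum_mono) (auto simp: prime_exps_def c1 lookup_add)
      with c d assms(3) show False by linarith
    qed
  qed
  then have "{e. c + e \<in> veronese_exps UNIV d a} = prime_exps F"
    by (auto simp: veronese_exps_def prime_exps_def)
  then have "colon (mideal (veronese_exps UNIV d a)) (monomial c) = (var_ideal F :: ('n, 'k) mpoly set)"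
    by (simp only: colon_mideal)
  then show ?thesis by blast
qed

theorem theorem2p5:
  fixes d :: nat
    and a :: "'n::{finite,linorder} \<Rightarrow> nat"
    and I :: "('n, 'k::field) mpoly set"
  assumes "d \<ge> 1"
    and "antimono a"
    and "\<And>j. 1 \<le> a j \<and> a j \<le> d"
    and "I = veronese_ideal d a"
  shows "almost_Cohen_Macaulay I \<longleftrightarrow> big_height poly_ring I - height poly_ring I \<le> 1"
proof -
  define E where "E = veronese_exps UNIV d a"
  define n where "n = CARD('n)"
  define h where "h = mheight E"
  let ?M = "quot_module poly_ring I"
  have IE: "I = mideal E" using assms(4) by (simp add: E_def veronese_ideal_eq)
  have E: "upset E" "0 \<notin> E"
    using assms(1) by (simp_all add: E_def upset_veronese_exps zero_notin_veronese_exps)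
  have I: "ideal' I" unfolding IE by (rule ideal'_mideal[OF E(1)])
  have m: "irrelevant_ideal = (mideal (order_exps 1) :: ('n, 'k) mpoly set)"
    by (simp only: irrelevant_ideal_eq var_ideal_UNIV)
  have ht: "height poly_ring I = enat h"
    by (simp add: IE h_def height_mideal E(2))
  have dim: "Krull_dim (poly_ring Quot I) = enat (n - h)"
    by (simp add: IE h_def n_def Krull_dim_mideal E)
  have h: "h \<le> n"
    using mheight_attained[OF E(2)] card_mono[of UNIV] unfolding h_def n_def by (metis finite subset_UNIV)
  \<comment> \<open>The height is finite, so it can be moved across the inequality; truncation at 0
    does no harm.\<close>
  have bight: "big_height poly_ring I - height poly_ring I \<le> 1 \<longleftrightarrow> big_height poly_ring I \<le> enat (h + 1)"
    unfolding ht by (cases "big_height poly_ring I") (auto simp: one_enat_def)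
  have aCM: "almost_Cohen_Macaulay I \<longleftrightarrow> enat (n - h - 1) \<le> depth poly_ring irrelevant_ideal ?M"
    by (simp add: almost_Cohen_Macaulay_def dim one_enat_def)
  \<comment> \<open>Neither \<open>I\<close> nor the list contributes a constant term, so weakly
    regular sequences in the irrelevant ideal are regular.\<close>
  have proper: "1 \<notin> adjs I fs" if "set fs \<subseteq> irrelevant_ideal" for fs
  proof -
    have "E \<subseteq> order_exps 1"
    proof
      fix e assume "e \<in> E"
      then have "edeg e \<noteq> 0" using E(2) by (auto simp: edeg_eq_0_iff)
      then show "e \<in> order_exps 1" by (simp add: order_exps_def)
    qed
    then have "adjs I fs \<subseteq> mideal (order_exps 1)"
      using that unfolding IE m by (intro adjs_least ideal'_mideal upset_order_exps mideal_mono)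
    then show ?thesis by (auto simp: order_exps_def edeg_def)
  qed
  show ?thesis
    unfolding bight aCM
  proof
    assume depth: "enat (n - h - 1) \<le> depth poly_ring irrelevant_ideal ?M"
    \<comment> \<open>A bound of 0 is met by the empty list; \<open>enat_le_SUP_imp\<close> needs a
      positive one.\<close>
    have "\<exists>fs. set fs \<subseteq> irrelevant_ideal \<and> wreg I fs \<and> n - h - 1 \<le> length fs"
    proof (cases "n - h - 1 = 0")
      case True
      then show ?thesis by (intro exI[of _ "[]"]) simp
    next
      case False
      from enat_le_SUP_imp[OF depth[unfolded depth_def] this] show ?thesis
        by (auto simp: regular_sequence_quot_module_iff[OF I])
    qed
    then obtain fs where fs: "set fs \<subseteq> mideal (order_exps 1)" "wreg I fs" "n - h - 1 \<le> length fs"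
      unfolding m by blast
    show "big_height poly_ring I \<le> enat (h + 1)"
      unfolding big_height_def associated_primes_quot_module[OF I] prime_height_def
    proof (intro SUP_least, clarify)
      fix C c u
      assume C: "prime_chain poly_ring C c" "C c = colon I u"
      have "c + length fs \<le> n"
        unfolding n_def
        by (rule prime_chain_plus_regular_sequence_le[OF E(1) C(1) C(2)[unfolded IE] fs(2)[unfolded IE] fs(1)])
      then show "enat c \<le> enat (h + 1)" using fs(3) h by simp
    qed
  next
    assume big: "big_height poly_ring I \<le> enat (h + 1)"
    define s where "s = (\<Sum>j\<in>UNIV. a j)"
    define b where "b = min n (s + 1 - d)"
    have "b \<le> h + 1"
    proof (cases "b = 0")
      case False
      obtain F :: "'n set" where F: "card F = b"
        using obtain_subset_with_card_n[of b "UNIV :: 'n set"] by (auto simp: b_def n_def)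
      have "b = card F * 1" by (simp add: F)
      also have "\<dots> \<le> (\<Sum>j\<in>F. a j)" using assms(3) sum_bounded_below[of F 1 a] by simp
      finally have bF: "b \<le> (\<Sum>j\<in>F. a j)" .
      have s: "s = (\<Sum>j\<in>F. a j) + (\<Sum>j\<in>- F. a j)"
        unfolding s_def by (subst sum.union_disjoint[symmetric]) (auto intro!: sum.cong)
      \<comment> \<open>If \<open>b < n\<close>, then \<open>b = s + 1 - d\<close>, and
        \<open>bF\<close> bounds the sum outside \<open>F\<close> by \<open>s - b = d - 1\<close>.
        If \<open>b = n\<close>, the complement is empty.\<close>
      have "(\<Sum>j\<in>- F. a j) < d"
      proof (cases "b = n")
        case True
        then have "F = UNIV" using F by (intro card_subset_eq) (simp_all add: n_def)
        then show ?thesis using assms(1) by simp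
      next
        case False
        then show ?thesis using bF s assms(1) by (simp add: b_def min_def split: if_splits)
      qed
      moreover have "d + card F \<le> 1 + s" using F False by (auto simp: b_def min_def)
      moreover have "F \<noteq> {}" using F False by auto
      ultimately obtain c where c: "colon I (monomial c) = var_ideal F"
        using colon_veronese[of a F d] assms(3) unfolding IE E_def s_def by blast
      have "var_ideal F \<in> associated_primes poly_ring ?M"
        unfolding associated_primes_quot_module[OF I] using c primeideal_var_ideal[of F] by auto
      then have "prime_height poly_ring (var_ideal F :: ('n, 'k) mpoly set) \<le> big_height poly_ring I"
        unfolding big_height_def by (rule SUP_upper)
      with big have "enat b \<le> enat (h + 1)"
        using prime_height_ge_card[OF primeideal_var_ideal, of F F] F by (auto dest: order_trans)
      then show ?thesis by simp
    qed simp
    define fs where "fs = (esyms (n - b) :: ('n, 'k) mpoly list)"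
    \<comment> \<open>For \<open>b = n\<close> the list is empty; the inequality in
      \<open>wreg_veronese\<close> can then fail, since \<open>s + 1 - d\<close> may exceed
      \<open>n\<close>.\<close>
    have "wreg I fs"
    proof (cases "b = n")
      case False
      then have "n - b + 1 + s \<le> d + n" by (simp add: b_def min_def split: if_splits)
      then show ?thesis
        unfolding fs_def IE E_def s_def by (intro wreg_veronese) (simp_all add: n_def)
    qed (simp add: fs_def)
    moreover have "set fs \<subseteq> irrelevant_ideal"
      unfolding fs_def m by (auto simp del: upt_Suc One_nat_def intro: esym_in_order_ideal)
    ultimately have "enat (length fs) \<le> depth poly_ring irrelevant_ideal ?M"
      unfolding depth_def using proper by (intro SUP_upper) (simp add: regular_sequence_quot_module_iff[OF I])
    moreover have "n - h - 1 \<le> length fs" using \<open>b \<le> h + 1\<close> by (simp add: fs_def del: upt_Suc)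
    ultimately show "enat (n - h - 1) \<le> depth poly_ring irrelevant_ideal ?M"
      by (meson enat_ord_simps(1) order_trans)
  qed
qed

end
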